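(* Let $G$ be a connected Feynman graph and let $\gamma\subset E_G$ be a momentum-spanning edge-subgraph. Then $$\Phi_G(q)=\Phi_\gamma(q)\,\Psi_{G/\gamma}+R^{\Phi,\mathrm{IR}}_{\gamma,G}(q),$$ where the degree of $R^{\Phi,\mathrm{IR}}_{\gamma,G}(q)$ in the variables $\alpha_e$, $e\in E_\gamma$ (i.e. the degree in these variables of every monomial occurring in it), is strictly greater than $\deg\Phi_\gamma(q)=h_\gamma+1$.
   Context: A Feynman graph $G=(V_G,E_G,E_G^{\mathrm{ext}})$ is a finite graph with vertices $V_G$, internal edges $E_G$ (multiple edges and self-edges allowed) and external half-edges $E_G^{\mathrm{ext}}$, each attached to a vertex, such that all vertices carrying external half-edges lie in one connected component. Each external half-edge $i$ carries an incoming momentum $q_i\in\mathbb R^d$ and $\sum_i q_i=0$. $h_G$ denotes the loop number (first Betti number) of $G$. A subset $\gamma\subset E_G$ is identified with the edge-subgraph with edge set $E_\gamma=\gamma$ and vertex set $V_\gamma$ the set of endpoints of edges in $\gamma$; it may be disconnected. It is momentum-spanning if all vertices of $G$ carrying external half-edges belong to $V_\gamma$ and lie in a single connected component of $\gamma$; in this case $\gamma$ inherits all external half-edges and momenta of $G$. The quotient $G/\gamma$ is obtained by removing the edges of $\gamma$ and identifying all vertices in each connected component of $\gamma$. To each internal edge $e$ is associated a variable $\alpha_e$. A spanning $k$-tree of a graph is a subgraph containing all vertices, with no loops and exactly $k$ connected components. For $G$ connected, $$\Psi_G=\sum_{T}\prod_{e\notin T}\alpha_e,\qquad \Phi_G(q)=\sum_{T_1\cup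 T_2}(q^{T_1})^2\prod_{e\notin T_1\cup T_2}\alpha_e,$$ where the sums are over spanning trees $T$ and spanning $2$-trees $T_1\cup T_2$ of $G$, and $q^{T_1}$ is the sum of the momenta entering $T_1$ (so $q^{T_1}=-q^{T_2}$). If a Feynman graph has connected components $G_0$ (containing all external momenta)$,G_1,\dots,G_n$, then its polynomials are $\Psi=\prod_{i\ge0}\Psi_{G_i}$ and $\Phi(q)=\Phi_{G_0}(q)\prod_{i\ge1}\Psi_{G_i}$. *)

theory Defs
  imports
    "HOL-Analysis.Finite_Cartesian_Product"
    "HOL-Analysis.Finite_Function_Topology"
    "Graph_Theory.Digraph_Component"
begin

section \<open>Undirected multigraphs\<close>

text \<open>
  A finite graph with multiple edges and self-edges is a finite \<^typ>\<open>('v, 'e) pre_digraph\<close>.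
  Its edges are undirected: which endpoint is called tail and which head is an arbitrary
  orientation. Connectivity is taken in the underlying symmetric graph, and the orientation
  is otherwise used only to fix signs in the boundary map. (The constants forest and
  tree of the library are not used: they exclude directed cycles only.)
\<close>

definition component :: "('v, 'e) pre_digraph \<Rightarrow> 'v \<Rightarrow> 'v set" where
  "component G v = {w. v \<rightarrow>\<^sup>*\<^bsub>with_proj (mk_symmetric G)\<^esub> w}"

definition components :: "('v, 'e) pre_digraph \<Rightarrow> 'v set set" where
  "components G = component G ` verts G"

text \<open>
  The loop number is the first Betti number, the dimension of the kernel of the
  boundary map from real 1-chains to real 0-chains.
\<close>

definition boundary :: "('v, 'e) pre_digraph \<Rightarrow> ('e \<Rightarrow>\<^sub>0 real) \<Rightarrow> ('v \<Rightarrow>\<^sub>0 real)" where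
  "boundary G c = (\<Sum>e\<in>Poly_Mapping.keys c. Poly_Mapping.lookup c e *\<^sub>R
     (Poly_Mapping.single (head G e) 1 - Poly_Mapping.single (tail G e) 1))"

definition cycle_space :: "('v, 'e) pre_digraph \<Rightarrow> ('e \<Rightarrow>\<^sub>0 real) set" where
  "cycle_space G = {c. Poly_Mapping.keys c \<subseteq> arcs G \<and> boundary G c = 0}"

definition loop_number :: "('v, 'e) pre_digraph \<Rightarrow> nat" where
  "loop_number G = dim (cycle_space G)"

text \<open>The subgraph with all vertices of \<open>G\<close> and edge set \<open>F\<close>.\<close>

definition spanning_subgraph :: "('v, 'e) pre_digraph \<Rightarrow> 'e set \<Rightarrow> ('v, 'e) pre_digraph" where
  "spanning_subgraph G F = G\<lparr>arcs := F\<rparr>"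

text \<open>A spanning \<open>k\<close>-tree contains all vertices, so it is given by its edge set.\<close>

definition spanning_trees :: "nat \<Rightarrow> ('v, 'e) pre_digraph \<Rightarrow> 'e set set" where
  "spanning_trees k G = {F. F \<subseteq> arcs G \<and> loop_number (spanning_subgraph G F) = 0 \<and>
     card (components (spanning_subgraph G F)) = k}"

definition edge_subgraph :: "('v, 'e) pre_digraph \<Rightarrow> 'e set \<Rightarrow> ('v, 'e) pre_digraph" where
  "edge_subgraph G \<gamma> = G\<lparr>verts := tail G ` \<gamma> \<union> head G ` \<gamma>, arcs := \<gamma>\<rparr>"

text \<open>
  A vertex of the quotient is the set of vertices of \<open>G\<close> that are identified in it: a connected
  component of \<open>\<gamma>\<close>, or a single vertex not incident with \<open>\<gamma>\<close>.
\<close>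

definition quotient_graph :: "('v, 'e) pre_digraph \<Rightarrow> 'e set \<Rightarrow> ('v set, 'e) pre_digraph" where
  "quotient_graph G \<gamma> =
    \<lparr>verts = components (spanning_subgraph G \<gamma>),
     arcs = arcs G - \<gamma>,
     tail = (\<lambda>e. component (spanning_subgraph G \<gamma>) (tail G e)),
     head = (\<lambda>e. component (spanning_subgraph G \<gamma>) (head G e))\<rparr>"


section \<open>Feynman graphs\<close>

record ('v, 'e, 'h, 'd) feynman_graph =
  skeleton :: "('v, 'e) pre_digraph"
  half_edges :: "'h set"
  attach :: "'h \<Rightarrow> 'v"
  momentum :: "'h \<Rightarrow> real ^ 'd"

definition feynman_graph :: "('v, 'e, 'h, 'd::finite) feynman_graph \<Rightarrow> bool" where
  "feynman_graph G \<longleftrightarrow>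
     fin_digraph (skeleton G) \<and>
     finite (half_edges G) \<and>
     attach G ` half_edges G \<subseteq> verts (skeleton G) \<and>
     (\<forall>i\<in>half_edges G. \<forall>j\<in>half_edges G. attach G j \<in> component (skeleton G) (attach G i)) \<and>
     (\<Sum>i\<in>half_edges G. momentum G i) = 0"

definition feynman_subgraph ::
    "('v, 'e, 'h, 'd::finite) feynman_graph \<Rightarrow> 'e set \<Rightarrow> ('v, 'e, 'h, 'd) feynman_graph" where
  "feynman_subgraph G \<gamma> = G\<lparr>skeleton := edge_subgraph (skeleton G) \<gamma>\<rparr>"

definition momentum_spanning ::
    "('v, 'e, 'h, 'd::finite) feynman_graph \<Rightarrow> 'e set \<Rightarrow> bool" where
  "momentum_spanning G \<gamma> \<longleftrightarrow>
     \<gamma> \<subseteq> arcs (skeleton G) \<and>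
     attach G ` half_edges G \<subseteq> verts (edge_subgraph (skeleton G) \<gamma>) \<and>
     (\<forall>i\<in>half_edges G. \<forall>j\<in>half_edges G.
        attach G j \<in> component (edge_subgraph (skeleton G) \<gamma>) (attach G i))"

definition momentum_into :: "('v, 'e, 'h, 'd::finite) feynman_graph \<Rightarrow> 'v set \<Rightarrow> real ^ 'd" where
  "momentum_into G T = (\<Sum>i | i \<in> half_edges G \<and> attach G i \<in> T. momentum G i)"


section \<open>Graph polynomials\<close>

text \<open>
  Polynomials in the variables \<open>\<alpha>\<^sub>e\<close>: a monomial is a finitely supported exponent function,
  and \<^const>\<open>Poly_Mapping.keys\<close> of a polynomial is the set of monomials occurring in it.
\<close>

type_synonym 'e polynomial = "('e \<Rightarrow>\<^sub>0 nat) \<Rightarrow>\<^sub>0 real"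

definition var :: "'e \<Rightarrow> 'e polynomial" where
  "var e = Poly_Mapping.single (Poly_Mapping.single e 1) 1"

definition const :: "real \<Rightarrow> 'e polynomial" where
  "const c = Poly_Mapping.single 0 c"

definition monomial_degree_in :: "'e set \<Rightarrow> ('e \<Rightarrow>\<^sub>0 nat) \<Rightarrow> nat" where
  "monomial_degree_in S m = (\<Sum>e \<in> Poly_Mapping.keys m \<inter> S. Poly_Mapping.lookup m e)"

text \<open>The total degree; it is only meaningful for nonzero polynomials.\<close>

definition total_degree :: "'e polynomial \<Rightarrow> nat" where
  "total_degree p = Max (monomial_degree_in UNIV ` Poly_Mapping.keys p)"

definition psi_conn :: "('v, 'e) pre_digraph \<Rightarrow> 'e polynomial" where
  "psi_conn G = (\<Sum>F\<in>spanning_trees 1 G. \<Prod>e\<in>arcs G - F. var e)"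

definition psi :: "('v, 'e) pre_digraph \<Rightarrow> 'e polynomial" where
  "psi G = (\<Prod>C\<in>components G. psi_conn (G \<restriction> C))"

text \<open>
  \<open>T\<^sub>1\<close> is either of the two components of the spanning 2-tree; by momentum conservation
  the two choices give opposite momenta.
\<close>

definition phi_conn :: "('v, 'e, 'h, 'd::finite) feynman_graph \<Rightarrow> 'e polynomial" where
  "phi_conn G = (\<Sum>F\<in>spanning_trees 2 (skeleton G).
     let T1 = (SOME T. T \<in> components (spanning_subgraph (skeleton G) F));
         q = momentum_into G T1
     in const (inner q q) * (\<Prod>e\<in>arcs (skeleton G) - F. var e))"

text \<open>
  Without external half-edges there is no distinguished component \<open>G\<^sub>0\<close> (and there may be no
  component at all, as the empty edge-subgraph has no vertices). All momenta \<open>q\<^bsup>T\<^sub>1\<^esup>\<close>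
  are then empty sums, so the polynomial is 0 whichever component is taken as \<open>G\<^sub>0\<close>.
\<close>

definition phi :: "('v, 'e, 'h, 'd::finite) feynman_graph \<Rightarrow> 'e polynomial" where
  "phi G =
    (if half_edges G = {} then 0
     else let C0 = (THE C. C \<in> components (skeleton G) \<and> attach G ` half_edges G \<subseteq> C)
       in phi_conn (G\<lparr>skeleton := skeleton G \<restriction> C0\<rparr>) *
          (\<Prod>C\<in>components (skeleton G) - {C0}. psi_conn (skeleton G \<restriction> C)))"

end

theory Submission
  imports Defs
begin

text \<open>
  By the Euler formula a spanning 2-tree \<open>D\<close> of \<open>G\<close> leaves out
  \<open>h\<^sub>\<gamma> + c(D \<inter> \<gamma>) - c(\<gamma>)\<close> edges of \<open>\<gamma>\<close>, where \<open>c\<close> counts components. If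
  \<open>c(D \<inter> \<gamma>) = c(\<gamma>)\<close> then \<open>D\<close> connects all external vertices and its coefficient vanishes by
  momentum conservation. The terms with \<open>c(D \<inter> \<gamma>) = c(\<gamma>) + 1\<close> and nonzero coefficient are those
  in which \<open>D \<inter> \<gamma>\<close> cuts the component of \<open>\<gamma>\<close> carrying the external vertices in two; for them
  \<open>D - \<gamma>\<close> is a spanning tree of \<open>G/\<gamma>\<close>, and \<open>D \<mapsto> (D \<inter> \<gamma>, D - \<gamma>)\<close> matches them with the
  terms of \<open>\<Phi>\<^sub>\<gamma> \<Psi>\<^bsub>G/\<gamma>\<^esub>\<close>. The momentum is read off at the component of one
  fixed external vertex, so that it is the same for \<open>D\<close> and \<open>D \<inter> \<gamma>\<close>.
\<close>

section \<open>Connectivity by a set of edges\<close>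

text \<open>The closure is taken on the whole vertex type and depends only on \<open>tail\<close>,
  \<open>head\<close> and \<open>F\<close>. So a graph, its subgraphs and its induced subgraphs
  share one relation.\<close>

definition linked :: "('v, 'e) pre_digraph \<Rightarrow> 'e set \<Rightarrow> 'v rel" where
  "linked G F = (\<Union>e\<in>F. {(tail G e, head G e), (head G e, tail G e)})\<^sup>*"

text \<open>The vertex set is a separate argument because the same edges are counted over
  \<open>verts G\<close>, over the vertices of \<gamma> and over single components.\<close>

definition ncomp :: "('v, 'e) pre_digraph \<Rightarrow> 'v set \<Rightarrow> 'e set \<Rightarrow> nat" where
  "ncomp G V F = card (V // linked G F)"

definition nullity :: "('v, 'e) pre_digraph \<Rightarrow> 'e set \<Rightarrow> nat" where
  "nullity G F = loop_number (spanning_subgraph G F)"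

lemma linked_refl [simp]: "(u, u) \<in> linked G F"
  by (simp add: linked_def)

lemma linked_sym: "(u, v) \<in> linked G F \<Longrightarrow> (v, u) \<in> linked G F"
proof -
  have "sym (linked G F)"
    unfolding linked_def by (intro sym_rtrancl symI) auto
  then show "(u, v) \<in> linked G F \<Longrightarrow> (v, u) \<in> linked G F"
    by (rule symD)
qed

lemma linked_trans: "(u, v) \<in> linked G F \<Longrightarrow> (v, w) \<in> linked G F \<Longrightarrow> (u, w) \<in> linked G F"
  unfolding linked_def by (rule rtrancl_trans)

lemma linked_edge: "e \<in> F \<Longrightarrow> (tail G e, head G e) \<in> linked G F"
  unfolding linked_def by (rule r_into_rtrancl) auto

lemma equiv_linked: "equiv UNIV (linked G F)"
  by (intro equivI refl_onI symI transI) (auto intro: linked_sym linked_trans)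

text \<open>Induction principle for connectivity, applied below with \<open>R\<close> chosen as the
  claim at hand: an equivalence relation equals its own reflexive transitive closure.\<close>

lemma linked_least:
  assumes "equiv UNIV R" "\<And>e. e \<in> F \<Longrightarrow> (tail G e, head G e) \<in> R"
  shows "linked G F \<subseteq> R"
proof -
  have "(\<Union>e\<in>F. {(tail G e, head G e), (head G e, tail G e)}) \<subseteq> R"
    using assms by (auto dest: equivE symD)
  then have "linked G F \<subseteq> R\<^sup>*"
    unfolding linked_def by (rule rtrancl_mono)
  also have "R\<^sup>* = R"
    using assms(1) by (metis equiv_def refl_on_def UNIV_I reflcl_trancl sup.absorb1
        trancl_id pair_in_Id_conv subrelI)
  finally show ?thesis .
qed

lemma linked_mono: "A \<subseteq> B \<Longrightarrow> linked G A \<subseteq> linked G B"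
  by (intro linked_least equiv_linked) (auto intro: linked_edge)

lemma linked_empty: "linked G {} = Id"
  by (simp add: linked_def)

lemma linked_cong: "tail G = tail H \<Longrightarrow> head G = head H \<Longrightarrow> linked G F = linked H F"
  by (simp add: linked_def)

text \<open>A walk needs the new edge at most once. Formally, the right-hand side is an equivalence
  relation containing all edges of \<open>insert e F\<close>, so \<open>linked_least\<close>
  applies.\<close>

lemma linked_insert:
  "(u, v) \<in> linked G (insert e F) \<longleftrightarrow> (u, v) \<in> linked G F \<or>
    (u, tail G e) \<in> linked G F \<and> (head G e, v) \<in> linked G F \<or>
    (u, head G e) \<in> linked G F \<and> (tail G e, v) \<in> linked G F" (is "?l \<longleftrightarrow> ?r u v")
proof
  have "equiv UNIV {(u, v). ?r u v}"
    by (intro equivI refl_onI symI transI) (blast intro: linked_sym linked_trans linked_refl)+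
  then have "linked G (insert e F) \<subseteq> {(u, v). ?r u v}"
    by (rule linked_least) (auto simp: linked_edge)
  then show "?l \<Longrightarrow> ?r u v"
    by blast
next
  have *: "linked G F \<subseteq> linked G (insert e F)"
    by (intro linked_mono) auto
  have "(tail G e, head G e) \<in> linked G (insert e F)"
    by (simp add: linked_edge)
  then show "?r u v \<Longrightarrow> ?l"
    using * by (meson subsetD linked_sym linked_trans)
qed

lemma linked_in:
  assumes "(u, v) \<in> linked G F" "tail G ` F \<subseteq> V" "head G ` F \<subseteq> V" "u \<in> V"
  shows "v \<in> V"
proof -
  have "linked G F \<subseteq> {(u, v). u \<in> V \<longleftrightarrow> v \<in> V}"
    using assms(2,3) by (intro linked_least equivI refl_onI symI transI) auto
  then show ?thesis
    using assms(1,4) by auto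
qed

lemma linked_class_eq_iff: "linked G F `` {u} = linked G F `` {v} \<longleftrightarrow> (u, v) \<in> linked G F"
  by (simp add: eq_equiv_class_iff[OF equiv_linked])

lemma ncomp_empty: "ncomp G V {} = card V"
proof -
  have "V // linked G {} = (\<lambda>v. {v}) ` V"
    by (auto simp: quotient_def linked_empty)
  then show ?thesis
    by (simp add: ncomp_def card_image)
qed

lemma ncomp_insert_linked:
  assumes "(tail G e, head G e) \<in> linked G F"
  shows "ncomp G V (insert e F) = ncomp G V F"
proof -
  have "linked G (insert e F) = linked G F"
    using assms unfolding set_eq_iff split_paired_All linked_insert
    by (meson linked_sym linked_trans)
  then show ?thesis
    by (simp add: ncomp_def)
qed

text \<open>The classes of the two ends fuse into their union, and all other classes stay as they
  are.\<close>

lemma ncomp_insert_unlinked: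
  assumes "(tail G e, head G e) \<notin> linked G F" "finite V" "tail G e \<in> V" "head G e \<in> V"
  shows "ncomp G V F = ncomp G V (insert e F) + 1"
proof -
  let ?L = "linked G F" and ?L' = "linked G (insert e F)"
  let ?T = "?L `` {tail G e}" and ?H = "?L `` {head G e}"
  have cls: "?L' `` {v} = (if ?L `` {v} \<in> {?T, ?H} then ?T \<union> ?H else ?L `` {v})" for v
  proof -
    have "?L' `` {v} = (if (v, tail G e) \<in> ?L \<or> (v, head G e) \<in> ?L then ?T \<union> ?H else ?L `` {v})"
      using assms(1) unfolding set_eq_iff Image_singleton_iff
      by (simp add: linked_insert) (meson linked_sym linked_trans)
    then show ?thesis
      by (simp add: linked_class_eq_iff)
  qed
  have quo: "V // R = (\<lambda>v. R `` {v}) ` V" for R :: "'a rel"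
    by (auto simp: quotient_def)
  have "V // ?L' = insert (?T \<union> ?H) (V // ?L - {?T, ?H})"
    using assms(3,4) unfolding quo cls by (auto simp: image_iff)
  \<comment> \<open>The fused class has to be new; otherwise the count would drop by two instead of
    one.\<close>
  moreover have "?T \<union> ?H \<notin> V // ?L"
  proof
    assume "?T \<union> ?H \<in> V // ?L"
    then obtain v where v: "?T \<union> ?H = ?L `` {v}"
      by (auto simp: quotient_def)
    then have "(v, tail G e) \<in> ?L" "(v, head G e) \<in> ?L"
      using linked_refl by fast+
    then show False
      using assms(1) by (meson linked_sym linked_trans)
  qed
  ultimately have "ncomp G V (insert e F) = Suc (card (V // ?L - {?T, ?H}))"
    using assms(2) by (simp add: ncomp_def quo)
  also have "card (V // ?L - {?T, ?H}) = ncomp G V F - 2"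
    using assms by (subst card_Diff_subset) (auto simp: ncomp_def quo linked_class_eq_iff card_insert_if)
  \<comment> \<open>The subtraction of 2 is truncated, so two distinct classes have to be exhibited
    before it can be undone.\<close>
  also have "ncomp G V F \<ge> card {?T, ?H}"
    unfolding ncomp_def using assms by (intro card_mono) (auto simp: quo)
  then have "ncomp G V F \<ge> 2"
    using assms by (simp add: linked_class_eq_iff)
  then have "Suc (ncomp G V F - 2) + 1 = ncomp G V F"
    by simp
  finally show ?thesis
    by simp
qed

text \<open>Diminishing returns, by induction on \<open>X\<close>: an edge whose ends are linked in
  \<open>A \<union> X\<close> has linked ends in \<open>B \<union> X\<close> too, so an edge that
  lowers the count over the larger set also lowers it over the smaller one.\<close>

lemma ncomp_submodular:
  assumes "A \<subseteq> B" "finite V" "finite X" "tail G ` X \<subseteq> V" "head G ` X \<subseteq> V"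
  shows "ncomp G V (A \<union> X) + ncomp G V B \<le> ncomp G V (B \<union> X) + ncomp G V A"
  using assms(3-)
proof (induction X)
  case (insert x X)
  have *: "linked G (A \<union> X) \<subseteq> linked G (B \<union> X)"
    using assms(1) by (intro linked_mono) auto
  have "ncomp G V (insert x (A \<union> X)) + ncomp G V (B \<union> X) \<le>
      ncomp G V (insert x (B \<union> X)) + ncomp G V (A \<union> X)"
  proof (cases "(tail G x, head G x) \<in> linked G (A \<union> X)")
    case True
    with * show ?thesis
      by (simp add: ncomp_insert_linked subsetD)
  next
    case False
    then have "ncomp G V (A \<union> X) = ncomp G V (insert x (A \<union> X)) + 1"
      using insert.prems assms(2) by (intro ncomp_insert_unlinked) auto
    moreover have "ncomp G V (B \<union> X) \<le> ncomp G V (insert x (B \<union> X)) + 1"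
      using insert.prems assms(2) ncomp_insert_linked[of G x "B \<union> X" V]
        ncomp_insert_unlinked[of G x "B \<union> X" V] by fastforce
    ultimately show ?thesis
      by linarith
  qed
  moreover have "ncomp G V (A \<union> X) + ncomp G V B \<le> ncomp G V (B \<union> X) + ncomp G V A"
    using insert by simp
  ultimately show ?case
    by simp
qed auto


section \<open>The Euler formula\<close>

lemma lookup_scaleR: "Poly_Mapping.lookup (r *\<^sub>R x) i = r *\<^sub>R Poly_Mapping.lookup x i"
proof -
  have "finite {i. r *\<^sub>R Poly_Mapping.lookup x i \<noteq> 0}"
    by (rule finite_subset[OF _ finite_lookup[of x]]) auto
  then show ?thesis
    by (simp add: scaleR_poly_mapping_def)
qed

text \<open>A summation range larger than the support lets chains with different supports be
  compared.\<close>

lemma boundary_eq_sum: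
  assumes "finite K" "Poly_Mapping.keys c \<subseteq> K"
  shows "boundary G c = (\<Sum>e\<in>K. Poly_Mapping.lookup c e *\<^sub>R
     (Poly_Mapping.single (head G e) 1 - Poly_Mapping.single (tail G e) 1))"
  unfolding boundary_def
  using assms by (intro sum.mono_neutral_left) (auto simp: in_keys_iff)

lemma linear_boundary:
  fixes G :: "('v, 'e) pre_digraph"
  shows "linear (boundary G)"
proof
  fix a b :: "'e \<Rightarrow>\<^sub>0 real" and r :: real
  let ?K = "Poly_Mapping.keys a \<union> Poly_Mapping.keys b"
  have "Poly_Mapping.keys (a + b) \<subseteq> ?K"
    by (rule keys_add)
  then show "boundary G (a + b) = boundary G a + boundary G b"
    by (simp add: boundary_eq_sum[of ?K] lookup_add scaleR_add_left sum.distrib)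
  have "Poly_Mapping.keys (r *\<^sub>R a) \<subseteq> Poly_Mapping.keys a"
    by (auto simp: in_keys_iff lookup_scaleR)
  then show "boundary G (r *\<^sub>R a) = r *\<^sub>R boundary G a"
    by (simp add: boundary_eq_sum[of "Poly_Mapping.keys a"] lookup_scaleR scaleR_sum_right)
qed

lemma cycle_space_spanning_subgraph:
  "cycle_space (spanning_subgraph G F) = {c. Poly_Mapping.keys c \<subseteq> F \<and> boundary G c = 0}"
  by (simp add: cycle_space_def spanning_subgraph_def boundary_def)

lemma subspace_cycle_space:
  fixes G :: "('v, 'e) pre_digraph"
  shows "subspace (cycle_space G)"
proof (rule subspaceI)
  show "0 \<in> cycle_space G"
    by (simp add: cycle_space_def linear_0[OF linear_boundary])
  fix x y :: "'e \<Rightarrow>\<^sub>0 real" and r :: real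
  assume x: "x \<in> cycle_space G"
  show "r *\<^sub>R x \<in> cycle_space G"
    using x by (auto simp: cycle_space_def in_keys_iff lookup_scaleR
        linear_scale[OF linear_boundary])
  assume "y \<in> cycle_space G"
  then show "x + y \<in> cycle_space G"
    using x keys_add[of x y] by (auto simp: cycle_space_def linear_add[OF linear_boundary])
qed

text \<open>The signed sum of the edges along a walk from \<open>u\<close> to \<open>v\<close> has
  boundary \<open>v - u\<close>. Walks stay implicit: the chains \<open>0\<close>,
  \<open>- c\<close> and \<open>c + d\<close> make \<open>?R\<close> an equivalence relation, and a
  single edge is its own chain.\<close>

lemma linked_imp_boundary:
  assumes "(u, v) \<in> linked G F"
  shows "\<exists>c. Poly_Mapping.keys c \<subseteq> F \<and>
    boundary G c = Poly_Mapping.single v 1 - Poly_Mapping.single u 1"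
proof -
  let ?R = "{(u, v). \<exists>c. Poly_Mapping.keys c \<subseteq> F \<and>
    boundary G c = Poly_Mapping.single v 1 - Poly_Mapping.single u 1}"
  have "equiv UNIV ?R"
  proof (intro equivI refl_onI symI transI)
    show "(u, u) \<in> ?R" for u
      by (auto intro!: exI[of _ 0] simp: linear_0[OF linear_boundary])
    show "(v, u) \<in> ?R" if uv: "(u, v) \<in> ?R" for u v
    proof -
      obtain c where "Poly_Mapping.keys c \<subseteq> F"
        "boundary G c = Poly_Mapping.single v 1 - Poly_Mapping.single u 1"
        using uv by auto
      then show ?thesis
        by (auto intro!: exI[of _ "- c"] simp: linear_neg[OF linear_boundary])
    qed
    show "(u, w) \<in> ?R" if uv: "(u, v) \<in> ?R" "(v, w) \<in> ?R" for u v w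
    proof -
      obtain c d where "Poly_Mapping.keys c \<subseteq> F" "Poly_Mapping.keys d \<subseteq> F"
        "boundary G c = Poly_Mapping.single v 1 - Poly_Mapping.single u 1"
        "boundary G d = Poly_Mapping.single w 1 - Poly_Mapping.single v 1"
        using uv by auto
      moreover have "Poly_Mapping.keys (c + d) \<subseteq> Poly_Mapping.keys c \<union> Poly_Mapping.keys d"
        by (rule keys_add)
      ultimately show ?thesis
        by (auto intro!: exI[of _ "c + d"] simp: linear_add[OF linear_boundary])
    qed
  qed simp
  moreover have "(tail G e, head G e) \<in> ?R" if "e \<in> F" for e
    using that by (auto intro!: exI[of _ "Poly_Mapping.single e 1"] simp: boundary_def)
  ultimately have "linked G F \<subseteq> ?R"
    by (rule linked_least)
  then show ?thesis
    using assms by auto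
qed

text \<open>Adding the boundary coefficients over the vertices in \<open>S\<close> gives the net
  flow of \<open>c\<close> into \<open>S\<close>.\<close>

lemma boundary_zero_cut:
  assumes "boundary G c = 0"
  shows "(\<Sum>e\<in>Poly_Mapping.keys c. Poly_Mapping.lookup c e *
    (of_bool (head G e \<in> S) - of_bool (tail G e \<in> S))) = 0"
proof -
  \<comment> \<open>\<open>S\<close> may be infinite; only ends of edges in the support can carry a
    boundary coefficient.\<close>
  let ?V = "(tail G ` Poly_Mapping.keys c \<union> head G ` Poly_Mapping.keys c) \<inter> S"
  have *: "(\<Sum>v\<in>?V. Poly_Mapping.lookup (Poly_Mapping.single w (1::real)) v) = of_bool (w \<in> S)"
    if "w \<in> tail G ` Poly_Mapping.keys c \<union> head G ` Poly_Mapping.keys c" for w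
  proof -
    have "(\<Sum>v\<in>?V. Poly_Mapping.lookup (Poly_Mapping.single w (1::real)) v) =
        (\<Sum>v\<in>?V. if v = w then 1 else 0)"
      by (intro sum.cong) (auto simp: lookup_single when_def)
    also have "\<dots> = of_bool (w \<in> S)"
      using that by (subst sum.delta) auto
    finally show ?thesis .
  qed
  have "0 = (\<Sum>v\<in>?V. Poly_Mapping.lookup (boundary G c) v)"
    by (simp add: assms)
  also have "\<dots> = (\<Sum>e\<in>Poly_Mapping.keys c. \<Sum>v\<in>?V. Poly_Mapping.lookup c e *
      (Poly_Mapping.lookup (Poly_Mapping.single (head G e) 1) v -
       Poly_Mapping.lookup (Poly_Mapping.single (tail G e) 1) v))"
    unfolding boundary_def lookup_sum lookup_scaleR lookup_minus real_scaleR_def by (rule sum.swap)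
  also have "\<dots> = (\<Sum>e\<in>Poly_Mapping.keys c. Poly_Mapping.lookup c e *
      (of_bool (head G e \<in> S) - of_bool (tail G e \<in> S)))"
    by (intro sum.cong refl) (simp add: sum_distrib_left[symmetric] sum_subtractf *)
  finally show ?thesis
    by simp
qed

text \<open>Edge by edge: an edge that closes a cycle adds one basis vector and keeps the
  components; any other edge keeps the cycle space and merges two components. With an explicit basis
  the dimension is a cardinality.\<close>

lemma euler_basis:
  assumes "finite F" "finite V" "tail G ` F \<subseteq> V" "head G ` F \<subseteq> V"
  shows "\<exists>B. finite B \<and> independent B \<and> span B = cycle_space (spanning_subgraph G F) \<and>
    card B + card V = card F + ncomp G V F"
  using assms(1,3,4)
proof (induction F)
  case empty
  have "cycle_space (spanning_subgraph G {}) = {0}"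
    using linear_0[OF linear_boundary] by (auto simp: cycle_space_spanning_subgraph)
  then have "finite {} \<and> independent {} \<and> span {} = cycle_space (spanning_subgraph G {}) \<and>
      card {} + card V = card {} + ncomp G V {}"
    by (simp add: independent_empty ncomp_empty)
  then show ?case
    by blast
next
  case (insert e F)
  let ?Z = "\<lambda>F. cycle_space (spanning_subgraph G F)"
  obtain B where B: "finite B" "independent B" "span B = ?Z F"
    "card B + card V = card F + ncomp G V F"
    using insert by auto
  show ?case
  proof (cases "(tail G e, head G e) \<in> linked G F")
    case True
    then obtain c where c: "Poly_Mapping.keys c \<subseteq> F"
      "boundary G c = Poly_Mapping.single (tail G e) 1 - Poly_Mapping.single (head G e) 1"
      using linked_imp_boundary linked_sym by metis
    \<comment> \<open>The new cycle: \<open>e\<close> closed up by a chain in \<open>F\<close>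
      running from its head back to its tail. Its coefficient 1 at \<open>e\<close> makes it
      independent of the old cycles.\<close>
    define z where "z = c + Poly_Mapping.single e 1"
    have ze: "Poly_Mapping.lookup z e = 1"
      using c(1) insert.hyps(2) by (auto simp: z_def lookup_add in_keys_iff)
    have bz: "boundary G z = 0"
      by (simp add: z_def linear_add[OF linear_boundary] c(2)) (simp add: boundary_def)
    have kz: "Poly_Mapping.keys z \<subseteq> insert e F"
      using c(1) keys_add[of c "Poly_Mapping.single e 1"] by (auto simp: z_def)
    have nz: "z \<notin> ?Z F"
      using ze insert.hyps(2) by (fastforce simp: cycle_space_spanning_subgraph in_keys_iff subset_iff)
    then have "z \<notin> span B" "z \<notin> B"
      using B(3) by (auto intro: span_base)
    moreover have "span (insert z B) = ?Z (insert e F)"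
    proof (intro set_eqI iffI)
      fix x assume "x \<in> span (insert z B)"
      then obtain k where "x - k *\<^sub>R z \<in> ?Z F"
        by (auto simp: span_breakdown_eq B(3))
      then have "x - k *\<^sub>R z \<in> ?Z (insert e F)" "z \<in> ?Z (insert e F)"
        using kz bz by (auto simp: cycle_space_spanning_subgraph)
      then have "x - k *\<^sub>R z + k *\<^sub>R z \<in> ?Z (insert e F)"
        by (intro subspace_add subspace_scale subspace_cycle_space)
      then show "x \<in> ?Z (insert e F)"
        by simp
    next
      fix x assume x: "x \<in> ?Z (insert e F)"
      \<comment> \<open>Subtracting this multiple of \<open>z\<close> cancels the coefficient at
        \<open>e\<close> and leaves a cycle supported in \<open>F\<close>.\<close>
      let ?k = "Poly_Mapping.lookup x e"
      have "x - ?k *\<^sub>R z \<in> ?Z (insert e F)"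
        using x kz bz by (intro subspace_diff subspace_scale subspace_cycle_space)
          (auto simp: cycle_space_spanning_subgraph)
      moreover have "Poly_Mapping.lookup (x - ?k *\<^sub>R z) e = 0"
        by (simp add: lookup_minus lookup_scaleR ze)
      ultimately have "x - ?k *\<^sub>R z \<in> ?Z F"
        by (auto simp: cycle_space_spanning_subgraph in_keys_iff)
      then show "x \<in> span (insert z B)"
        by (auto simp: span_breakdown_eq B(3))
    qed
    ultimately show ?thesis
      using B insert True
      by (intro exI[of _ "insert z B"]) (auto simp: independent_insertI ncomp_insert_linked)
  next
    case False
    have "Poly_Mapping.lookup c e = 0" if c: "c \<in> ?Z (insert e F)" for c
    proof (rule ccontr)
      assume nz: "Poly_Mapping.lookup c e \<noteq> 0"
      \<comment> \<open>No edge of \<open>F\<close> leaves the component of \<open>head G e\<close>,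
        so \<open>e\<close> alone contributes to the cut sum of a cycle, and its coefficient must
        vanish.\<close>
      let ?S = "linked G F `` {head G e}"
      let ?f = "\<lambda>e. Poly_Mapping.lookup c e * (of_bool (head G e \<in> ?S) - of_bool (tail G e \<in> ?S))"
      have "?f e' = 0" if "e' \<in> Poly_Mapping.keys c - {e}" for e'
      proof -
        have "e' \<in> F"
          using that c by (auto simp: cycle_space_spanning_subgraph)
        then have "head G e' \<in> ?S \<longleftrightarrow> tail G e' \<in> ?S"
          by (meson Image_singleton_iff linked_edge linked_sym linked_trans)
        then show ?thesis
          by simp
      qed
      then have "(\<Sum>e\<in>Poly_Mapping.keys c. ?f e) = ?f e"
        using nz by (subst sum.remove[of _ e]) (auto simp: in_keys_iff)
      moreover have "?f e \<noteq> 0"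
        using nz False linked_sym by fastforce
      ultimately show False
        using boundary_zero_cut[of G c ?S] c by (simp add: cycle_space_spanning_subgraph)
    qed
    then have "?Z (insert e F) = ?Z F"
      by (auto simp: cycle_space_spanning_subgraph in_keys_iff subset_iff)
    then show ?thesis
      using B insert False assms(2) ncomp_insert_unlinked[of G e F V] by (intro exI[of _ B]) auto
  qed
qed

lemma euler:
  assumes "finite F" "finite V" "tail G ` F \<subseteq> V" "head G ` F \<subseteq> V"
  shows "nullity G F + card V = card F + ncomp G V F"
proof -
  obtain B where "independent B" "span B = cycle_space (spanning_subgraph G F)"
    "card B + card V = card F + ncomp G V F"
    using euler_basis[OF assms] by auto
  moreover from this have "dim (cycle_space (spanning_subgraph G F)) = card B"
    using dim_eq_card_independent dim_span by metis
  ultimately show ?thesis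
    by (simp add: nullity_def loop_number_def)
qed


section \<open>Connected components\<close>

lemma quotient_linked: "V // linked G F = (\<lambda>v. linked G F `` {v}) ` V"
  by (auto simp: quotient_def)

lemma quotient_linked_connected:
  assumes "V \<noteq> {}" "V \<times> V \<subseteq> linked G F" "tail G ` F \<subseteq> V" "head G ` F \<subseteq> V"
  shows "V // linked G F = {V}"
proof -
  have "linked G F `` {v} = V" if "v \<in> V" for v
    using assms that linked_in[OF _ assms(3,4)] by auto
  then show ?thesis
    using assms(1) by (auto simp: quotient_linked)
qed

lemma ncomp_pos: "finite V \<Longrightarrow> V \<noteq> {} \<Longrightarrow> 0 < ncomp G V F"
  by (simp add: ncomp_def quotient_linked card_gt_0_iff)

lemma ncomp_eq_1_iff:
  assumes "finite V" "V \<noteq> {}"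
  shows "ncomp G V F = 1 \<longleftrightarrow> V \<times> V \<subseteq> linked G F"
proof
  assume "ncomp G V F = 1"
  then obtain C where C: "(\<lambda>v. linked G F `` {v}) ` V = {C}"
    by (auto simp: ncomp_def quotient_linked card_1_singleton_iff)
  then have "linked G F `` {u} = linked G F `` {v}" if "u \<in> V" "v \<in> V" for u v
    using that by (metis imageI singletonD)
  then show "V \<times> V \<subseteq> linked G F"
    by (auto simp: linked_class_eq_iff)
next
  assume V: "V \<times> V \<subseteq> linked G F"
  obtain w where w: "w \<in> V"
    using assms(2) by auto
  have "(\<lambda>v. linked G F `` {v}) ` V = {linked G F `` {w}}"
    using V w linked_class_eq_iff[of G F] by blast
  then show "ncomp G V F = 1"
    by (simp add: ncomp_def quotient_linked)
qed

text \<open>Saturation under \<open>linked G B\<close> maps the classes of \<open>A\<close> onto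
  those of \<open>B\<close>.\<close>

lemma ncomp_mono:
  assumes "A \<subseteq> B" "finite V"
  shows "ncomp G V B \<le> ncomp G V A"
proof -
  have "linked G B `` {v} = linked G B `` (linked G A `` {v})" for v
    using linked_mono[OF assms(1), of G] linked_trans[of _ _ G B] by fastforce
  then have "V // linked G B = (\<lambda>X. linked G B `` X) ` (V // linked G A)"
    unfolding quotient_linked image_image by simp
  then show ?thesis
    unfolding ncomp_def using assms(2) by (simp add: card_image_le quotient_linked)
qed

section \<open>Components of a graph as classes of \<open>linked\<close>\<close>

context wf_digraph
begin

lemma tail_head_subset:
  assumes "F \<subseteq> arcs G"
  shows "tail G ` F \<subseteq> verts G" "head G ` F \<subseteq> verts G"
  using assms by auto

text \<open>Reachability in the symmetrised graph is confined to \<open>verts G\<close>, whereas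
  \<open>linked\<close> is not; the two agree because no edge leaves \<open>verts G\<close>.\<close>

lemma component_eq_linked:
  assumes "v \<in> verts G"
  shows "component G v = linked G (arcs G) `` {v}"
proof -
  have "(v, w) \<in> linked G (arcs G) \<longleftrightarrow>
      (v, w) \<in> rtrancl_on (verts G) (\<Union>e\<in>arcs G. {(tail G e, head G e), (head G e, tail G e)})"
    (is "?l \<longleftrightarrow> ?r") for w
  proof
    assume l: ?l
    have "w \<in> verts G"
      by (rule linked_in[OF l tail_head_subset[OF subset_refl] assms])
    then show ?r
      by (intro rtrancl_consistent_rtrancl_on l[unfolded linked_def] assms) auto
  next
    assume ?r then show ?l
      unfolding linked_def by (rule rtrancl_on_rtranclI)
  qed
  then show ?thesis
    unfolding component_def reachable_def with_proj_simps pverts_mk_symmetric parcs_mk_symmetric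
    by blast
qed

lemma components_eq_quotient: "components G = verts G // linked G (arcs G)"
  by (simp add: components_def quotient_linked component_eq_linked)

lemma wf_spanning_subgraph: "F \<subseteq> arcs G \<Longrightarrow> wf_digraph (spanning_subgraph G F)"
  by unfold_locales (auto simp: spanning_subgraph_def)

lemma component_spanning_subgraph:
  assumes "F \<subseteq> arcs G" "v \<in> verts G"
  shows "component (spanning_subgraph G F) v = linked G F `` {v}"
  using wf_digraph.component_eq_linked[OF wf_spanning_subgraph[OF assms(1)], of v] assms(2)
  by (simp add: spanning_subgraph_def linked_def)

lemma components_spanning_subgraph:
  assumes "F \<subseteq> arcs G"
  shows "components (spanning_subgraph G F) = verts G // linked G F"
  using wf_digraph.components_eq_quotient[OF wf_spanning_subgraph[OF assms]]
  by (simp add: spanning_subgraph_def linked_def)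

lemma spanning_trees_eq:
  "spanning_trees k G = {F. F \<subseteq> arcs G \<and> nullity G F = 0 \<and> ncomp G (verts G) F = k}"
  by (auto simp: spanning_trees_def nullity_def ncomp_def components_spanning_subgraph)

lemma connected_components:
  assumes "verts G \<noteq> {}" "verts G \<times> verts G \<subseteq> linked G (arcs G)"
  shows "components G = {verts G}"
  unfolding components_eq_quotient
  using assms tail_head_subset by (intro quotient_linked_connected) auto

lemma connected_linked:
  assumes "Digraph_Component.connected G"
  shows "verts G \<noteq> {}" "verts G \<times> verts G \<subseteq> linked G (arcs G)"
proof -
  show "verts G \<noteq> {}"
    using assms by (simp add: Digraph_Component.connected_def strongly_connected_def)
  have "v \<in> component G u" if "u \<in> verts G" "v \<in> verts G" for u v
    using assms that
    by (simp add: Digraph_Component.connected_def strongly_connected_def component_def)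
  then show "verts G \<times> verts G \<subseteq> linked G (arcs G)"
    using component_eq_linked by auto
qed

lemma induce_subgraph_verts_eq: "G \<restriction> verts G = G"
  by (rule pre_digraph.equality) (auto simp: induce_subgraph_def)

lemma psi_connected:
  assumes "components G = {verts G}"
  shows "psi G = psi_conn G"
  by (simp add: psi_def assms induce_subgraph_verts_eq)

lemma components_disjoint:
  assumes "C \<in> components G" "D \<in> components G" "C \<noteq> D"
  shows "C \<inter> D = {}"
  using assms quotient_disj[OF equiv_linked, of C G "arcs G" D]
  unfolding components_eq_quotient by (auto simp: quotient_def)

lemma Union_components: "\<Union> (components G) = verts G"
proof -
  have "linked G (arcs G) `` {v} \<subseteq> verts G" if "v \<in> verts G" for v
    using that linked_in[OF _ tail_head_subset[OF subset_refl]] by blast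
  then show ?thesis
    unfolding components_eq_quotient quotient_linked using linked_refl by fastforce
qed

lemma component_nonempty: "C \<in> components G \<Longrightarrow> C \<noteq> {}"
  unfolding components_eq_quotient quotient_linked using linked_refl by fastforce

lemma component_closed:
  assumes "C \<in> components G" "e \<in> arcs G"
  shows "tail G e \<in> C \<longleftrightarrow> head G e \<in> C"
proof -
  obtain v where C: "C = linked G (arcs G) `` {v}"
    using assms(1) by (auto simp: components_eq_quotient quotient_linked)
  show ?thesis
    unfolding C Image_singleton_iff
    using linked_edge[OF assms(2), of G] by (meson linked_trans linked_sym)
qed

lemma arcs_induce_component:
  assumes "C \<in> components G"
  shows "arcs (G \<restriction> C) = {e \<in> arcs G. tail G e \<in> C}"
  using component_closed[OF assms] by (auto simp: induce_subgraph_def)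

lemma UN_arcs_components: "(\<Union>C\<in>components G. arcs (G \<restriction> C)) = arcs G"
proof -
  have "\<exists>C\<in>components G. tail G e \<in> C" if "e \<in> arcs G" for e
    using that Union_components tail_in_verts by blast
  then show ?thesis
    using component_closed by (simp add: set_eq_iff) blast
qed

lemma arcs_components_disjoint:
  assumes "C \<in> components G" "D \<in> components G" "C \<noteq> D"
  shows "arcs (G \<restriction> C) \<inter> arcs (G \<restriction> D) = {}"
  using components_disjoint[OF assms] assms by (auto simp: arcs_induce_component)

text \<open>A walk that starts in a component stays in it and so uses only its edges.\<close>

lemma linked_component:
  assumes "C \<in> components G" "F \<subseteq> arcs G" "u \<in> C"
  shows "linked G F `` {u} = linked G (F \<inter> arcs (G \<restriction> C)) `` {u}"
proof -
  let ?L = "linked G (F \<inter> arcs (G \<restriction> C))"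
  let ?R = "{(x, y). (x \<in> C \<longleftrightarrow> y \<in> C) \<and> (x \<in> C \<longrightarrow> (x, y) \<in> ?L)}"
  have "equiv UNIV ?R"
    by (intro equivI refl_onI symI transI) (force | (simp, meson linked_sym linked_trans))+
  moreover have "(tail G e, head G e) \<in> ?R" if "e \<in> F" for e
    using that assms component_closed[OF assms(1), of e]
    by (auto simp: arcs_induce_component intro!: linked_edge)
  ultimately have "linked G F \<subseteq> ?R"
    by (rule linked_least)
  moreover have "?L \<subseteq> linked G F"
    by (intro linked_mono) auto
  ultimately show ?thesis
    using assms(3) by auto
qed

end

lemma wf_induce_subgraph: "wf_digraph (G \<restriction> C)"
  by unfold_locales (auto simp: induce_subgraph_def)

lemma linked_induce_subgraph [simp]: "linked (G \<restriction> C) F = linked G F"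
  by (rule linked_cong) auto

lemma ncomp_induce_subgraph [simp]: "ncomp (G \<restriction> C) V F = ncomp G V F"
  by (simp add: ncomp_def)

lemma nullity_cong: "tail G = tail H \<Longrightarrow> head G = head H \<Longrightarrow> nullity G F = nullity H F"
  by (simp add: nullity_def loop_number_def cycle_space_spanning_subgraph boundary_def)

lemma nullity_induce_subgraph [simp]: "nullity (G \<restriction> C) F = nullity G F"
  by (rule nullity_cong) auto

section \<open>Additivity over connected components\<close>

context fin_digraph
begin

lemma finite_components: "finite (components G)"
  by (simp add: components_def)

text \<open>The components partition vertices and edges. They also partition the classes of
  \<open>F\<close>: a class shared by two components would give a walk inside one of them ending in
  the other.\<close>

lemma sum_over_components:
  fixes f :: "'b set \<Rightarrow> nat"
  assumes "F \<subseteq> arcs G"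
  shows "card (verts G) = (\<Sum>C\<in>components G. card C)"
    "card F = (\<Sum>C\<in>components G. card (F \<inter> arcs (G \<restriction> C)))"
    "ncomp G (verts G) F = (\<Sum>C\<in>components G. ncomp G C (F \<inter> arcs (G \<restriction> C)))"
proof -
  have fin: "finite C" if "C \<in> components G" for C
    using that Union_components finite_verts finite_subset[of C "verts G"] by blast
  show "card (verts G) = (\<Sum>C\<in>components G. card C)"
    unfolding Union_components[symmetric]
    using fin components_disjoint by (intro card_Union_disjoint) (auto simp: pairwise_def disjnt_def)
  have F: "F = (\<Union>C\<in>components G. F \<inter> arcs (G \<restriction> C))"
    using assms UN_arcs_components by blast
  have fF: "finite F"
    using assms finite_arcs finite_subset by blast
  show "card F = (\<Sum>C\<in>components G. card (F \<inter> arcs (G \<restriction> C)))"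
  proof -
    have "card F = card (\<Union>C\<in>components G. F \<inter> arcs (G \<restriction> C))"
      using F by (rule arg_cong)
    also have "\<dots> = (\<Sum>C\<in>components G. card (F \<inter> arcs (G \<restriction> C)))"
      using finite_components fF arcs_components_disjoint by (intro card_UN_disjoint) blast+
    finally show ?thesis .
  qed
  have "C // linked G (F \<inter> arcs (G \<restriction> C)) = C // linked G F" if "C \<in> components G" for C
    unfolding quotient_linked using linked_component[OF that assms] by (intro image_cong) auto
  then have nc: "ncomp G C (F \<inter> arcs (G \<restriction> C)) = card (C // linked G F)" if "C \<in> components G" for C
    using that by (simp add: ncomp_def)
  have "verts G // linked G F = (\<Union>C\<in>components G. C // linked G F)"
    unfolding quotient_linked Union_components[symmetric] by auto
  then have "ncomp G (verts G) F = card (\<Union>C\<in>components G. C // linked G F)"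
    by (simp add: ncomp_def)
  also have "\<dots> = (\<Sum>C\<in>components G. card (C // linked G F))"
  proof (rule card_UN_disjoint)
    show "\<forall>C\<in>components G. \<forall>D\<in>components G. C \<noteq> D \<longrightarrow> C // linked G F \<inter> D // linked G F = {}"
    proof (intro ballI impI, rule ccontr)
      fix C D assume CD: "C \<in> components G" "D \<in> components G" "C \<noteq> D"
        "C // linked G F \<inter> D // linked G F \<noteq> {}"
      then obtain u v where uv: "u \<in> C" "v \<in> D" "linked G F `` {u} = linked G F `` {v}"
        by (auto simp: quotient_linked)
      then have "(u, v) \<in> linked G F"
        by (simp add: linked_class_eq_iff)
      then have "v \<in> linked G (F \<inter> arcs (G \<restriction> C)) `` {u}"
        using linked_component[OF CD(1) assms uv(1)] by auto
      then have "v \<in> C"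
        using uv(1) linked_in[of u v G "F \<inter> arcs (G \<restriction> C)" C] by (auto simp: induce_subgraph_def)
      then show False
        using CD components_disjoint uv by blast
    qed
  qed (use fin finite_components in \<open>auto simp: quotient_linked\<close>)
  also have "\<dots> = (\<Sum>C\<in>components G. ncomp G C (F \<inter> arcs (G \<restriction> C)))"
    by (rule sum.cong) (simp_all only: nc)
  finally show "ncomp G (verts G) F = (\<Sum>C\<in>components G. ncomp G C (F \<inter> arcs (G \<restriction> C)))" .
qed

lemma euler_verts:
  assumes "F \<subseteq> arcs G"
  shows "nullity G F + card (verts G) = card F + ncomp G (verts G) F"
  by (intro euler tail_head_subset[OF assms] finite_verts finite_subset[OF assms finite_arcs])

text \<open>The other three terms of the Euler formula are additive over the components, hence so is
  this one.\<close>

lemma nullity_sum: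
  assumes "F \<subseteq> arcs G"
  shows "nullity G F = (\<Sum>C\<in>components G. nullity G (F \<inter> arcs (G \<restriction> C)))"
proof -
  have "nullity G (F \<inter> arcs (G \<restriction> C)) + card C =
      card (F \<inter> arcs (G \<restriction> C)) + ncomp G C (F \<inter> arcs (G \<restriction> C))" if "C \<in> components G" for C
  proof (rule euler)
    show "finite C"
      using that Union_components finite_verts finite_subset[of C "verts G"] by blast
    show "finite (F \<inter> arcs (G \<restriction> C))"
      using assms finite_arcs finite_subset[of "F \<inter> arcs (G \<restriction> C)" "arcs G"] by blast
  qed (auto simp: induce_subgraph_def)
  then have "(\<Sum>C\<in>components G. nullity G (F \<inter> arcs (G \<restriction> C)) + card C) =
      (\<Sum>C\<in>components G. card (F \<inter> arcs (G \<restriction> C)) + ncomp G C (F \<inter> arcs (G \<restriction> C)))"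
    by (intro sum.cong) auto
  then show ?thesis
    using euler_verts[OF assms] sum_over_components[OF assms] by (simp add: sum.distrib)
qed

text \<open>Submodularity, translated by the Euler formula, bounds the nullity of \<open>B\<close>
  below by the sum of those of \<open>A\<close> and \<open>B - A\<close>.\<close>

lemma nullity_mono:
  assumes "A \<subseteq> B" "B \<subseteq> arcs G"
  shows "nullity G A \<le> nullity G B"
proof -
  have fin: "finite B"
    by (rule finite_subset[OF assms(2) finite_arcs])
  have AB: "A \<union> (B - A) = B" "A \<subseteq> arcs G" "B - A \<subseteq> arcs G"
    using assms by auto
  have "ncomp G (verts G) ({} \<union> (B - A)) + ncomp G (verts G) A \<le>
      ncomp G (verts G) (A \<union> (B - A)) + ncomp G (verts G) {}"
    using fin tail_head_subset[OF AB(3)] by (intro ncomp_submodular) auto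
  moreover have "card B = card A + card (B - A)"
    using assms(1) fin by (metis card_Diff_subset card_mono finite_subset le_add_diff_inverse)
  moreover have "ncomp G (verts G) {} = card (verts G)"
    by (rule ncomp_empty)
  ultimately show ?thesis
    using euler_verts[OF AB(2)] euler_verts[OF assms(2)] euler_verts[OF AB(3)] AB(1) by simp
qed

end


section \<open>Monomials\<close>

definition indicator_exponent :: "'e set \<Rightarrow> ('e \<Rightarrow>\<^sub>0 nat)" where
  "indicator_exponent F = (\<Sum>e\<in>F. Poly_Mapping.single e 1)"

lemma prod_var: "(\<Prod>e\<in>F. var e) = Poly_Mapping.single (indicator_exponent F) 1"
  by (induction F rule: infinite_finite_induct) (auto simp: indicator_exponent_def var_def mult_single)

lemma const_mult_prod_var:
  "const c * (\<Prod>e\<in>F. var e) = Poly_Mapping.single (indicator_exponent F) c"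
  by (simp add: prod_var const_def mult_single)

lemma lookup_indicator_exponent:
  "finite F \<Longrightarrow> Poly_Mapping.lookup (indicator_exponent F) e = of_bool (e \<in> F)"
  by (simp add: indicator_exponent_def lookup_sum lookup_single when_def)

lemma monomial_degree_in_indicator_exponent:
  assumes "finite F"
  shows "monomial_degree_in S (indicator_exponent F) = card (F \<inter> S)"
proof -
  have "Poly_Mapping.keys (indicator_exponent F) = F"
    by (auto simp: in_keys_iff lookup_indicator_exponent[OF assms])
  then show ?thesis
    by (simp add: monomial_degree_in_def lookup_indicator_exponent[OF assms])
qed

text \<open>The condition \<open>c F \<noteq> 0\<close> is kept because momentum conservation will
  restrict the occurring monomials through it.\<close>

lemma keys_sum_const_mult_prod_var:
  "Poly_Mapping.keys (\<Sum>F\<in>N. const (c F) * (\<Prod>e\<in>E - F. var e)) \<subseteq>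
    (\<lambda>F. indicator_exponent (E - F)) ` {F \<in> N. c F \<noteq> 0}"
proof -
  have "Poly_Mapping.keys (\<Sum>F\<in>N. const (c F) * (\<Prod>e\<in>E - F. var e)) \<subseteq>
      (\<Union>F\<in>N. Poly_Mapping.keys (const (c F) * (\<Prod>e\<in>E - F. var e)))"
    by (rule keys_sum)
  then show ?thesis
    by (auto simp: const_mult_prod_var split: if_splits)
qed

section \<open>The second Symanzik polynomial as a sum over forests\<close>

definition flow_square :: "('v, 'e, 'h, 'd::finite) feynman_graph \<Rightarrow> 'h \<Rightarrow> 'e set \<Rightarrow> real" where
  "flow_square G i F =
    (let q = momentum_into G (linked (skeleton G) F `` {attach G i}) in inner q q)"

text \<open>For a component \<open>C\<close> these index the second Symanzik polynomial of a
  possibly disconnected graph: a spanning 2-tree of \<open>C\<close> with spanning trees of the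
  other components. One extra class means that one component is cut in two, and the last condition
  says that it is \<open>C\<close>.\<close>

definition cut_forests :: "('v, 'e) pre_digraph \<Rightarrow> 'v set \<Rightarrow> 'e set set" where
  "cut_forests G C = {F. F \<subseteq> arcs G \<and> nullity G F = 0 \<and>
     ncomp G (verts G) F = ncomp G (verts G) (arcs G) + 1 \<and> \<not> C \<times> C \<subseteq> linked G F}"

text \<open>The two trees of a spanning 2-tree cover all external vertices, so their inflows add up
  to the total momentum 0. The square is therefore the same for the chosen tree and for the one
  containing \<open>attach G i\<close>.\<close>

lemma phi_conn_eq:
  fixes G :: "('v, 'e, 'h, 'd::finite) feynman_graph"
  assumes "wf_digraph (skeleton G)" "finite (half_edges G)"
    and "attach G ` half_edges G \<subseteq> verts (skeleton G)"
    and "(\<Sum>i\<in>half_edges G. momentum G i) = 0" "i \<in> half_edges G"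
  shows "phi_conn G = (\<Sum>F\<in>spanning_trees 2 (skeleton G).
    const (flow_square G i F) * (\<Prod>e\<in>arcs (skeleton G) - F. var e))"
  unfolding phi_conn_def
proof (rule sum.cong[OF refl])
  interpret wf_digraph "skeleton G" by fact
  fix F assume "F \<in> spanning_trees 2 (skeleton G)"
  then have F: "F \<subseteq> arcs (skeleton G)" "card (verts (skeleton G) // linked (skeleton G) F) = 2"
    by (auto simp: spanning_trees_eq ncomp_def)
  let ?C = "verts (skeleton G) // linked (skeleton G) F"
  define T where "T = (SOME T. T \<in> components (spanning_subgraph (skeleton G) F))"
  define T0 where "T0 = linked (skeleton G) F `` {attach G i}"
  have T0: "T0 \<in> ?C"
    using assms(3,5) by (auto simp: T0_def quotient_linked)
  then have T: "T \<in> ?C"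
    unfolding T_def components_spanning_subgraph[OF F(1)] by (rule someI)
  have "inner (momentum_into G T) (momentum_into G T) = flow_square G i F"
  proof (cases "T = T0")
    case True
    then show ?thesis
      by (simp add: flow_square_def T0_def Let_def)
  next
    case False
    obtain A B where "?C = {A, B}"
      using F(2) by (auto simp: card_2_iff)
    then have C: "?C = {T, T0}"
      using T T0 False by auto
    have "v \<in> T \<union> T0" if "v \<in> verts (skeleton G)" for v
    proof -
      have "linked (skeleton G) F `` {v} \<in> ?C"
        using that by (auto simp: quotient_linked)
      then have "linked (skeleton G) F `` {v} = T \<or> linked (skeleton G) F `` {v} = T0"
        unfolding C by simp
      then show ?thesis
        using linked_refl[of v "skeleton G" F] by blast
    qed
    then have "{j \<in> half_edges G. attach G j \<in> T} \<union> {j \<in> half_edges G. attach G j \<in> T0} =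
        half_edges G"
      using assms(3) by blast
    moreover have "T \<inter> T0 = {}"
      using quotient_disj[OF equiv_linked, of T "skeleton G" F T0] T T0 False
      by (auto simp: quotient_def)
    ultimately have "momentum_into G T + momentum_into G T0 = 0"
      using assms(2,4) unfolding momentum_into_def
      by (subst sum.union_disjoint[symmetric]) auto
    then have "momentum_into G T = - momentum_into G T0"
      by (simp add: add_eq_0_iff2)
    then show ?thesis
      by (simp add: flow_square_def T0_def Let_def)
  qed
  then show "(let T1 = SOME T. T \<in> components (spanning_subgraph (skeleton G) F);
      q = momentum_into G T1
    in const (inner q q) * prod var (arcs (skeleton G) - F)) =
      const (flow_square G i F) * prod var (arcs (skeleton G) - F)"
    by (simp add: T_def Let_def)
qed

text \<open>A sum of nullities vanishes exactly when each summand does. For the counts, every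
  component contributes at least 1 and a disconnected \<open>C0\<close> at least 2; the total leaves
  no slack, so all these bounds are attained.\<close>

lemma (in fin_digraph) cut_forests_iff:
  assumes "F \<subseteq> arcs G" "C0 \<in> components G"
  shows "F \<in> cut_forests G C0 \<longleftrightarrow> (\<forall>C\<in>components G.
    F \<inter> arcs (G \<restriction> C) \<in> spanning_trees (if C = C0 then 2 else 1) (G \<restriction> C))"
proof -
  let ?E = "\<lambda>C. arcs (G \<restriction> C)" and ?k = "\<lambda>C. if C = C0 then 2 else 1 :: nat"
  have fin: "finite C" and ne: "C \<noteq> {}" if "C \<in> components G" for C
    using that Union_components finite_verts finite_subset[of C "verts G"] component_nonempty
    by blast+
  have conn: "ncomp G C (F \<inter> ?E C) = 1 \<longleftrightarrow> C \<times> C \<subseteq> linked G F"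
    if "C \<in> components G" "F \<subseteq> arcs G" for C F
  proof -
    have "C \<times> C \<subseteq> linked G (F \<inter> ?E C) \<longleftrightarrow> C \<times> C \<subseteq> linked G F"
      using linked_component[OF that] by blast
    then show ?thesis
      using ncomp_eq_1_iff[OF fin ne] that by blast
  qed
  have "C \<times> C \<subseteq> linked G (arcs G)" if "C \<in> components G" for C
    using that unfolding components_eq_quotient quotient_linked
    by (auto intro: linked_trans[OF linked_sym])
  then have "ncomp G (verts G) (arcs G) = card (components G)"
    using sum_over_components(3)[of "arcs G"] conn[of _ "arcs G"] by simp
  then have k: "(\<Sum>C\<in>components G. ?k C) = ncomp G (verts G) (arcs G) + 1"
    using assms(2) finite_components card_Suc_Diff1[OF finite_components assms(2)]
    by (subst sum.remove[of _ C0]) auto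
  have st: "spanning_trees k (G \<restriction> C) = {F. F \<subseteq> ?E C \<and> nullity G F = 0 \<and> ncomp G C F = k}" for k C
    using wf_digraph.spanning_trees_eq[OF wf_induce_subgraph] by auto
  have pos: "0 < ncomp G C (F \<inter> ?E C)" if "C \<in> components G" for C
    using that fin ne by (intro ncomp_pos) auto
  have "F \<in> cut_forests G C0 \<longleftrightarrow> (\<forall>C\<in>components G. nullity G (F \<inter> ?E C) = 0) \<and>
      (\<Sum>C\<in>components G. ncomp G C (F \<inter> ?E C)) = (\<Sum>C\<in>components G. ?k C) \<and>
      ncomp G C0 (F \<inter> ?E C0) \<noteq> 1"
    unfolding k cut_forests_def using assms finite_components
    by (simp only: nullity_sum[OF assms(1)] sum_over_components(3)[OF assms(1)] conn sum_eq_0_iff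
        mem_Collect_eq simp_thms)
  also have "\<dots> \<longleftrightarrow> (\<forall>C\<in>components G. nullity G (F \<inter> ?E C) = 0) \<and>
      (\<forall>C\<in>components G. ncomp G C (F \<inter> ?E C) = ?k C)" (is "?N \<and> ?S \<and> ?O \<longleftrightarrow> ?N \<and> ?A")
  proof -
    have "?A" if S: ?S and O: ?O
    proof
      fix C assume C: "C \<in> components G"
      have "?k D \<le> ncomp G D (F \<inter> ?E D)" if "D \<in> components G" for D
        using pos[OF that] O by auto
      then show "ncomp G C (F \<inter> ?E C) = ?k C"
        using sum_mono_inv[OF S[symmetric] _ C finite_components] by simp
    qed
    moreover have "?S \<and> ?O" if ?A
      using that assms(2) by (auto intro: sum.cong)
    ultimately show ?thesis
      by blast
  qed
  also have "\<dots> \<longleftrightarrow> (\<forall>C\<in>components G. F \<inter> ?E C \<in> spanning_trees (?k C) (G \<restriction> C))"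
    by (auto simp only: st)
  finally show ?thesis .
qed

text \<open>The product over components of sums over forests expands into a sum over choices of one
  forest per component. A choice is recovered from its union, since the components partition the
  edges.\<close>

lemma phi_eq:
  fixes G :: "('v, 'e, 'h, 'd::finite) feynman_graph"
  assumes "feynman_graph G" "i \<in> half_edges G"
  shows "phi G = (\<Sum>F\<in>cut_forests (skeleton G) (component (skeleton G) (attach G i)).
    const (flow_square G i F) * (\<Prod>e\<in>arcs (skeleton G) - F. var e))"
proof -
  let ?S = "skeleton G"
  interpret fin_digraph ?S
    using assms(1) by (simp add: feynman_graph_def)
  let ?E = "\<lambda>C. arcs (?S \<restriction> C)"
  define C0 where "C0 = component ?S (attach G i)"
  define k where "k C = (if C = C0 then 2 else 1 :: nat)" for C
  define w where "w C F = const (if C = C0 then flow_square G i F else 1) * (\<Prod>e\<in>?E C - F. var e)" for C F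
  have i: "attach G i \<in> verts ?S"
    using assms by (auto simp: feynman_graph_def)
  then have C0: "C0 \<in> components ?S" "attach G i \<in> C0"
    by (auto simp: C0_def components_def component_eq_linked)
  have att: "attach G ` half_edges G \<subseteq> C0"
    using assms by (auto simp: feynman_graph_def C0_def)
  have "(THE C. C \<in> components ?S \<and> attach G ` half_edges G \<subseteq> C) = C0"
  proof (rule the_equality)
    fix C assume "C \<in> components ?S \<and> attach G ` half_edges G \<subseteq> C"
    then show "C = C0"
      using C0 components_disjoint[of C C0] assms(2) by blast
  qed (use C0 att in simp)
  then have "phi G = phi_conn (G\<lparr>skeleton := ?S \<restriction> C0\<rparr>) *
      (\<Prod>C\<in>components ?S - {C0}. psi_conn (?S \<restriction> C))"
    using assms(2) by (auto simp: phi_def Let_def)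
  also have "phi_conn (G\<lparr>skeleton := ?S \<restriction> C0\<rparr>) = (\<Sum>F\<in>spanning_trees (k C0) (?S \<restriction> C0). w C0 F)"
    using assms att
    by (subst phi_conn_eq[where i = i])
      (auto simp: feynman_graph_def wf_induce_subgraph flow_square_def momentum_into_def k_def w_def)
  also have "(\<Prod>C\<in>components ?S - {C0}. psi_conn (?S \<restriction> C)) =
      (\<Prod>C\<in>components ?S - {C0}. \<Sum>F\<in>spanning_trees (k C) (?S \<restriction> C). w C F)"
    by (intro prod.cong) (auto simp: psi_conn_def k_def w_def const_def)
  also have "(\<Sum>F\<in>spanning_trees (k C0) (?S \<restriction> C0). w C0 F) * \<dots> =
      (\<Prod>C\<in>components ?S. \<Sum>F\<in>spanning_trees (k C) (?S \<restriction> C). w C F)"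
    by (rule prod.remove[symmetric, OF finite_components C0(1)])
  also have "\<dots> = (\<Sum>g\<in>PiE (components ?S) (\<lambda>C. spanning_trees (k C) (?S \<restriction> C)).
      \<Prod>C\<in>components ?S. w C (g C))"
  proof (rule prod_sum_PiE[OF finite_components])
    fix C
    have "spanning_trees (k C) (?S \<restriction> C) \<subseteq> Pow (arcs ?S)"
      by (auto simp: spanning_trees_def)
    then show "finite (spanning_trees (k C) (?S \<restriction> C))"
      by (rule finite_subset) simp
  qed
  also have "\<dots> = (\<Sum>F\<in>cut_forests ?S C0. const (flow_square G i F) * (\<Prod>e\<in>arcs ?S - F. var e))"
  proof (rule sum.reindex_bij_witness[symmetric, of _ "\<lambda>g. \<Union>C\<in>components ?S. g C"
        "\<lambda>F. restrict (\<lambda>C. F \<inter> ?E C) (components ?S)"])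
    fix F assume F: "F \<in> cut_forests ?S C0"
    then have FE: "F \<subseteq> arcs ?S"
      by (simp add: cut_forests_def)
    show "(\<Union>C\<in>components ?S. restrict (\<lambda>C. F \<inter> ?E C) (components ?S) C) = F"
    proof -
      have "(\<Union>C\<in>components ?S. restrict (\<lambda>C. F \<inter> ?E C) (components ?S) C) =
          F \<inter> (\<Union>C\<in>components ?S. ?E C)"
        by auto
      then show ?thesis
        using FE UN_arcs_components by auto
    qed
    show "restrict (\<lambda>C. F \<inter> ?E C) (components ?S) \<in>
        PiE (components ?S) (\<lambda>C. spanning_trees (k C) (?S \<restriction> C))"
      using F unfolding cut_forests_iff[OF FE C0(1)] k_def by (intro restrict_PiE_iff[THEN iffD2])
    \<comment> \<open>\<open>attach G i\<close> lies in \<open>C0\<close>, so the flow does not see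
      the edges of \<open>F\<close> in other components.\<close>
    have "linked ?S F `` {attach G i} = linked ?S (F \<inter> ?E C0) `` {attach G i}"
      by (rule linked_component[OF C0(1) FE C0(2)])
    then have Q: "flow_square G i (F \<inter> ?E C0) = flow_square G i F"
      by (simp only: flow_square_def)
    have "(\<Prod>C\<in>components ?S. w C (F \<inter> ?E C)) =
        (\<Prod>C\<in>components ?S. const (if C = C0 then flow_square G i (F \<inter> ?E C) else 1)) *
        (\<Prod>C\<in>components ?S. \<Prod>e\<in>?E C - F \<inter> ?E C. var e)"
      by (simp only: w_def prod.distrib)
    also have "(\<Prod>C\<in>components ?S. const (if C = C0 then flow_square G i (F \<inter> ?E C) else 1)) =
        const (flow_square G i F)"
      using C0(1) finite_components Q
      by (subst prod.remove[of _ C0]) (auto intro!: prod.neutral simp: const_def)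
    also have "(\<Prod>C\<in>components ?S. \<Prod>e\<in>?E C - F \<inter> ?E C. var e) =
        (\<Prod>e\<in>(\<Union>C\<in>components ?S. ?E C - F \<inter> ?E C). var e)"
    proof (rule prod.UNION_disjoint[symmetric, OF finite_components])
      show "\<forall>C\<in>components ?S. finite (?E C - F \<inter> ?E C)"
        by simp
      show "\<forall>C\<in>components ?S. \<forall>D\<in>components ?S. C \<noteq> D \<longrightarrow>
          (?E C - F \<inter> ?E C) \<inter> (?E D - F \<inter> ?E D) = {}"
        using arcs_components_disjoint by blast
    qed
    also have "(\<Union>C\<in>components ?S. ?E C - F \<inter> ?E C) = (\<Union>C\<in>components ?S. ?E C) - F"
      by blast
    finally show "(\<Prod>C\<in>components ?S. w C (restrict (\<lambda>C. F \<inter> ?E C) (components ?S) C)) =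
        const (flow_square G i F) * (\<Prod>e\<in>arcs ?S - F. var e)"
      unfolding UN_arcs_components by simp
  next
    fix g assume g: "g \<in> PiE (components ?S) (\<lambda>C. spanning_trees (k C) (?S \<restriction> C))"
    let ?F = "\<Union>C\<in>components ?S. g C"
    have gE: "g C \<subseteq> ?E C" if "C \<in> components ?S" for C
      using PiE_mem[OF g that] by (simp add: spanning_trees_def)
    then have FE: "?F \<subseteq> arcs ?S"
      using UN_arcs_components by blast
    have r: "?F \<inter> ?E C = g C" if "C \<in> components ?S" for C
      using gE that arcs_components_disjoint by blast
    show "restrict (\<lambda>C. ?F \<inter> ?E C) (components ?S) = g"
      using PiE_restrict[OF g] restrict_cong[OF refl, of "components ?S" "\<lambda>C. ?F \<inter> ?E C" g] r
      by (simp add: simp_implies_def)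
    show "?F \<in> cut_forests ?S C0"
      unfolding cut_forests_iff[OF FE C0(1)]
      using g r by (auto simp only: k_def[symmetric] intro: PiE_mem)
  qed
  finally show ?thesis
    by (simp only: C0_def)
qed

section \<open>Quotients\<close>

text \<open>A single edge of \<open>B\<close> joining two classes of \<open>A\<close> would already
  make the count drop.\<close>

lemma linked_eq_if_ncomp_le:
  assumes "A \<subseteq> B" "finite V" "tail G ` B \<subseteq> V" "head G ` B \<subseteq> V"
    and "ncomp G V A \<le> ncomp G V B"
  shows "linked G B = linked G A"
proof
  have "(tail G e, head G e) \<in> linked G A" if e: "e \<in> B" for e
  proof (rule ccontr)
    assume "(tail G e, head G e) \<notin> linked G A"
    then have "ncomp G V A = ncomp G V (insert e A) + 1"
      using assms e by (intro ncomp_insert_unlinked) auto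
    moreover have "ncomp G V B \<le> ncomp G V (insert e A)"
      using assms e by (intro ncomp_mono) auto
    ultimately show False
      using assms(5) by simp
  qed
  then show "linked G B \<subseteq> linked G A"
    by (intro linked_least equiv_linked)
qed (rule linked_mono[OF assms(1)])

text \<open>
  Since \<open>B\<close> merges only one pair of classes of \<open>A\<close>, any pair that it newly connects
  determines this merging.
\<close>

lemma linked_subset_if_one_merge:
  assumes "A \<subseteq> B" "finite V" "tail G ` B \<subseteq> V" "head G ` B \<subseteq> V"
    and "ncomp G V A \<le> ncomp G V B + 1" "A \<subseteq> D"
    and "(u, v) \<in> linked G B" "(u, v) \<notin> linked G A" "(u, v) \<in> linked G D"
  shows "linked G B \<subseteq> linked G D"
proof (rule linked_least[OF equiv_linked])
  fix e assume e: "e \<in> B"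
  have AD: "linked G A \<subseteq> linked G D"
    by (rule linked_mono[OF assms(6)])
  show "(tail G e, head G e) \<in> linked G D"
  proof (cases "(tail G e, head G e) \<in> linked G A")
    case False
    then have "ncomp G V A = ncomp G V (insert e A) + 1"
      using assms e by (intro ncomp_insert_unlinked) auto
    \<comment> \<open>Adding \<open>e\<close> alone exhausts the one permitted merge, so
      \<open>u\<close> and \<open>v\<close> get joined through \<open>e\<close>; as \<open>D\<close>
      joins \<open>u\<close> and \<open>v\<close>, it joins the ends of \<open>e\<close>.\<close>
    then have "linked G B = linked G (insert e A)"
      using assms e by (intro linked_eq_if_ncomp_le[of _ _ V]) auto
    then have "(u, tail G e) \<in> linked G A \<and> (head G e, v) \<in> linked G A \<or>
        (u, head G e) \<in> linked G A \<and> (tail G e, v) \<in> linked G A"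
      using assms(7,8) linked_insert[of u v G e A] by simp
    then show ?thesis
      using assms(9) subsetD[OF AD] by (meson linked_sym linked_trans)
  qed (use AD in blast)
qed

lemma linked_edge_subgraph [simp]: "linked (edge_subgraph G A) F = linked G F"
  by (rule linked_cong) (auto simp: edge_subgraph_def)

lemma ncomp_edge_subgraph [simp]: "ncomp (edge_subgraph G A) V F = ncomp G V F"
  by (simp add: ncomp_def)

lemma nullity_edge_subgraph [simp]: "nullity (edge_subgraph G A) F = nullity G F"
  by (rule nullity_cong) (auto simp: edge_subgraph_def)

lemma loop_number_edge_subgraph: "loop_number (edge_subgraph G \<gamma>) = nullity G \<gamma>"
  by (simp add: nullity_def loop_number_def cycle_space_def spanning_subgraph_def
      edge_subgraph_def boundary_def)

lemma arcs_edge_subgraph [simp]: "arcs (edge_subgraph G \<gamma>) = \<gamma>"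
  by (simp add: edge_subgraph_def)

section \<open>The quotient graph: connectivity, Euler formula, first Symanzik polynomial\<close>

context fin_digraph
begin

lemma fin_digraph_edge_subgraph:
  assumes "\<gamma> \<subseteq> arcs G"
  shows "fin_digraph (edge_subgraph G \<gamma>)"
  using finite_subset[OF assms finite_arcs]
  by unfold_locales (auto simp: edge_subgraph_def)

lemma quotient_graph_simps:
  assumes "\<gamma> \<subseteq> arcs G"
  shows "verts (quotient_graph G \<gamma>) = verts G // linked G \<gamma>"
    and "arcs (quotient_graph G \<gamma>) = arcs G - \<gamma>"
    and "e \<in> arcs G \<Longrightarrow> tail (quotient_graph G \<gamma>) e = linked G \<gamma> `` {tail G e}"
    and "e \<in> arcs G \<Longrightarrow> head (quotient_graph G \<gamma>) e = linked G \<gamma> `` {head G e}"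
  using assms
  by (simp_all add: quotient_graph_def components_spanning_subgraph component_spanning_subgraph)

lemma fin_digraph_quotient:
  assumes "\<gamma> \<subseteq> arcs G"
  shows "fin_digraph (quotient_graph G \<gamma>)"
  by unfold_locales (auto simp: quotient_graph_simps[OF assms] quotient_linked)

text \<open>A walk along \<open>F\<close> in the quotient is a walk along \<open>F\<close> in
  \<open>G\<close> with free moves along \<gamma>. Both directions use \<open>linked_least\<close>,
  once on vertices and once on classes.\<close>

lemma linked_quotient_graph:
  assumes "\<gamma> \<subseteq> arcs G" "F \<subseteq> arcs G" "u \<in> verts G" "v \<in> verts G"
  shows "(linked G \<gamma> `` {u}, linked G \<gamma> `` {v}) \<in> linked (quotient_graph G \<gamma>) F \<longleftrightarrow>
    (u, v) \<in> linked G (\<gamma> \<union> F)"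
proof
  let ?K = "quotient_graph G \<gamma>" and ?cl = "\<lambda>u. linked G \<gamma> `` {u}"
  have sub: "linked G \<gamma> \<subseteq> linked G (\<gamma> \<union> F)"
    by (intro linked_mono) auto
  {
    let ?R = "{(x, y). (x \<in> verts G \<longleftrightarrow> y \<in> verts G) \<and>
      (x \<in> verts G \<longrightarrow> (?cl x, ?cl y) \<in> linked ?K F)}"
    have "equiv UNIV ?R"
      by (intro equivI refl_onI symI transI) (force | (simp, meson linked_sym linked_trans))+
    moreover have "(tail G e, head G e) \<in> ?R" if "e \<in> \<gamma> \<union> F" for e
    proof -
      have e: "e \<in> arcs G"
        using that assms by auto
      have "(?cl (tail G e), ?cl (head G e)) \<in> linked ?K F"
      proof (cases "e \<in> \<gamma>")
        case True
        then have "?cl (tail G e) = ?cl (head G e)"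
          unfolding linked_class_eq_iff by (rule linked_edge)
        then show ?thesis
          by simp
      next
        case False
        then show ?thesis
          using linked_edge[of e F ?K] that quotient_graph_simps(3,4)[OF assms(1) e] by simp
      qed
      then show ?thesis
        using e by simp
    qed
    ultimately have "linked G (\<gamma> \<union> F) \<subseteq> ?R"
      by (rule linked_least)
    then show "(u, v) \<in> linked G (\<gamma> \<union> F) \<Longrightarrow> (?cl u, ?cl v) \<in> linked ?K F"
      using assms(3) by auto
  }
  \<comment> \<open>On the quotient, \<open>linked\<close> relates every set of vertices to itself,
    even one that is not a class; \<open>X = Y\<close> supplies reflexivity there.\<close>
  let ?R = "{(X, Y). X = Y \<or> (\<exists>u v. X = ?cl u \<and> Y = ?cl v \<and> (u, v) \<in> linked G (\<gamma> \<union> F))}"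
  \<comment> \<open>Two representatives of a class are joined by \<gamma>, so the choice of
    representatives is immaterial.\<close>
  have cl: "(x, y) \<in> linked G (\<gamma> \<union> F)" if "?cl x = ?cl y" for x y
    using that sub unfolding linked_class_eq_iff by blast
  have "equiv UNIV ?R"
  proof (intro equivI refl_onI symI transI)
    show "(Y, X) \<in> ?R" if XY: "(X, Y) \<in> ?R" for X Y
    proof (cases "X = Y")
      case False
      then obtain a b where "X = ?cl a" "Y = ?cl b" "(a, b) \<in> linked G (\<gamma> \<union> F)"
        using XY by blast
      then show ?thesis
        using linked_sym[of a b] by blast
    qed simp
    show "(X, Z) \<in> ?R" if XY: "(X, Y) \<in> ?R" and YZ: "(Y, Z) \<in> ?R" for X Y Z
    proof (cases "X = Y \<or> Y = Z")
      case False
      then obtain a b c d where abcd: "X = ?cl a" "Y = ?cl b" "(a, b) \<in> linked G (\<gamma> \<union> F)"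
        "Y = ?cl c" "Z = ?cl d" "(c, d) \<in> linked G (\<gamma> \<union> F)"
        using XY YZ by blast
      then have "(a, d) \<in> linked G (\<gamma> \<union> F)"
        using cl[of b c] by (metis linked_trans)
      then show ?thesis
        using abcd by blast
    qed (use XY YZ in auto)
  qed auto
  moreover have "(tail ?K e, head ?K e) \<in> ?R" if "e \<in> F" for e
  proof -
    have "e \<in> arcs G" "(tail G e, head G e) \<in> linked G (\<gamma> \<union> F)"
      using that assms(2) by (auto intro: linked_edge)
    then show ?thesis
      using quotient_graph_simps(3,4)[OF assms(1)] by blast
  qed
  ultimately have "linked ?K F \<subseteq> ?R"
    by (rule linked_least)
  moreover assume "(?cl u, ?cl v) \<in> linked ?K F"
  ultimately consider "?cl u = ?cl v"
    | u' v' where "?cl u = ?cl u'" "?cl v = ?cl v'" "(u', v') \<in> linked G (\<gamma> \<union> F)"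
    by auto
  then show "(u, v) \<in> linked G (\<gamma> \<union> F)"
    by cases (rule cl, assumption, metis cl linked_sym linked_trans)
qed

lemma ncomp_quotient_graph_eq_1_iff:
  assumes "\<gamma> \<subseteq> arcs G" "F \<subseteq> arcs G" "verts G \<noteq> {}"
  shows "ncomp (quotient_graph G \<gamma>) (verts (quotient_graph G \<gamma>)) F = 1 \<longleftrightarrow>
    ncomp G (verts G) (\<gamma> \<union> F) = 1"
proof -
  have V: "verts (quotient_graph G \<gamma>) = (\<lambda>v. linked G \<gamma> `` {v}) ` verts G"
    by (simp add: quotient_graph_simps[OF assms(1)] quotient_linked)
  then have "ncomp (quotient_graph G \<gamma>) (verts (quotient_graph G \<gamma>)) F = 1 \<longleftrightarrow>
      verts (quotient_graph G \<gamma>) \<times> verts (quotient_graph G \<gamma>) \<subseteq> linked (quotient_graph G \<gamma>) F"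
    using assms(3) by (intro ncomp_eq_1_iff) auto
  also have "\<dots> \<longleftrightarrow> (\<forall>u\<in>verts G. \<forall>v\<in>verts G.
      (linked G \<gamma> `` {u}, linked G \<gamma> `` {v}) \<in> linked (quotient_graph G \<gamma>) F)"
    unfolding V by blast
  also have "\<dots> \<longleftrightarrow> verts G \<times> verts G \<subseteq> linked G (\<gamma> \<union> F)"
    using linked_quotient_graph[OF assms(1,2)] by blast
  also have "\<dots> \<longleftrightarrow> ncomp G (verts G) (\<gamma> \<union> F) = 1"
    using ncomp_eq_1_iff[OF finite_verts assms(3)] by blast
  finally show ?thesis .
qed

text \<open>The quotient has one vertex per class of \<gamma> on \<open>verts G\<close>, which turns
  its vertex count into \<open>ncomp G (verts G) \<gamma>\<close>.\<close>

lemma euler_quotient_graph: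
  assumes "\<gamma> \<subseteq> arcs G" "F \<subseteq> arcs G - \<gamma>"
  shows "nullity (quotient_graph G \<gamma>) F + ncomp G (verts G) \<gamma> =
    card F + ncomp (quotient_graph G \<gamma>) (verts (quotient_graph G \<gamma>)) F"
  using fin_digraph.euler_verts[OF fin_digraph_quotient[OF assms(1)], of F] assms
  by (simp add: quotient_graph_simps ncomp_def)

text \<open>A quotient of a connected graph is connected, so the product defining \<open>psi\<close>
  has a single factor.\<close>

lemma psi_quotient_graph:
  assumes "\<gamma> \<subseteq> arcs G" "Digraph_Component.connected G"
  shows "psi (quotient_graph G \<gamma>) =
    (\<Sum>F\<in>spanning_trees 1 (quotient_graph G \<gamma>). \<Prod>e\<in>arcs G - \<gamma> - F. var e)"
proof -
  interpret K: fin_digraph "quotient_graph G \<gamma>"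
    by (rule fin_digraph_quotient[OF assms(1)])
  note conn = connected_linked[OF assms(2)]
  have K: "verts (quotient_graph G \<gamma>) \<noteq> {}"
    using conn(1) by (simp add: quotient_graph_simps[OF assms(1)] quotient_linked)
  have "\<gamma> \<union> (arcs G - \<gamma>) = arcs G"
    using assms(1) by auto
  then have "ncomp (quotient_graph G \<gamma>) (verts (quotient_graph G \<gamma>)) (arcs G - \<gamma>) = 1"
    using ncomp_quotient_graph_eq_1_iff[OF assms(1) _ conn(1), of "arcs G - \<gamma>"]
      ncomp_eq_1_iff[OF finite_verts conn(1)] conn(2) by auto
  then have "components (quotient_graph G \<gamma>) = {verts (quotient_graph G \<gamma>)}"
    unfolding ncomp_eq_1_iff[OF K.finite_verts K]
    by (intro K.connected_components K) (simp only: quotient_graph_simps(2)[OF assms(1)])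
  then show ?thesis
    by (simp add: K.psi_connected psi_conn_def quotient_graph_simps(2)[OF assms(1)])
qed

end


section \<open>Spanning 2-trees relative to a subgraph\<close>

context fin_digraph
begin

lemma euler_edge_subgraph:
  assumes "\<gamma> \<subseteq> arcs G" "F \<subseteq> \<gamma>"
  shows "nullity G F + card (verts (edge_subgraph G \<gamma>)) =
    card F + ncomp G (verts (edge_subgraph G \<gamma>)) F"
  using fin_digraph.euler_verts[OF fin_digraph_edge_subgraph[OF assms(1)], of F] assms(2) by simp

text \<open>Vertices not incident with \<gamma> add the same number of isolated classes to both
  counts; formally, the Euler formula is compared over the two vertex sets.\<close>

lemma ncomp_cut_forest:
  assumes "\<gamma> \<subseteq> arcs G" "F \<in> cut_forests (edge_subgraph G \<gamma>) C"
  shows "ncomp G (verts G) F = ncomp G (verts G) \<gamma> + 1"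
proof -
  have F: "F \<subseteq> \<gamma>" "nullity G F = 0"
    "ncomp G (verts (edge_subgraph G \<gamma>)) F = ncomp G (verts (edge_subgraph G \<gamma>)) \<gamma> + 1"
    using assms(2) by (auto simp: cut_forests_def)
  then show ?thesis
    using euler_edge_subgraph[OF assms(1) F(1)] euler_edge_subgraph[OF assms(1) subset_refl]
      euler_verts[of F] euler_verts[OF assms(1)] assms(1) by auto
qed

text \<open>Subtracting the Euler formulas of \<gamma> and \<open>F\<close>. This is the degree of
  every term of the polynomial of \<gamma>.\<close>

lemma card_cut_forest:
  assumes "\<gamma> \<subseteq> arcs G" "F \<in> cut_forests (edge_subgraph G \<gamma>) C"
  shows "card (\<gamma> - F) = nullity G \<gamma> + 1"
proof -
  have F: "F \<subseteq> \<gamma>" "nullity G F = 0"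
    using assms(2) by (auto simp: cut_forests_def)
  have fin: "finite \<gamma>"
    by (rule finite_subset[OF assms(1) finite_arcs])
  have "card (\<gamma> - F) + card F = card \<gamma>"
    using F(1) fin by (metis add.commute card_Diff_subset card_mono finite_subset le_add_diff_inverse)
  then show ?thesis
    using ncomp_cut_forest[OF assms] euler_verts[of F] euler_verts[OF assms(1)] F assms(1) by auto
qed

text \<open>\<open>T\<close> contributes just enough edges to leave two components. It cannot repair
  the cut that \<open>F\<close> makes in \<gamma>, since \<open>F \<union> T\<close> would then
  connect everything.\<close>

lemma cut_forest_union_spanning_tree:
  assumes "\<gamma> \<subseteq> arcs G" "verts G \<noteq> {}" "F \<in> cut_forests (edge_subgraph G \<gamma>) C"
    and "T \<in> spanning_trees 1 (quotient_graph G \<gamma>)"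
  shows "F \<union> T \<in> spanning_trees 2 G"
    and "(u, v) \<in> linked G \<gamma> \<Longrightarrow> (u, v) \<in> linked G (F \<union> T) \<Longrightarrow> (u, v) \<in> linked G F"
proof -
  let ?n = "ncomp G (verts G)" and ?K = "quotient_graph G \<gamma>"
  interpret K: fin_digraph ?K
    by (rule fin_digraph_quotient[OF assms(1)])
  have F: "F \<subseteq> \<gamma>" "nullity G F = 0"
    using assms(3) by (auto simp: cut_forests_def)
  have T: "T \<subseteq> arcs G - \<gamma>" "nullity ?K T = 0" "ncomp ?K (verts ?K) T = 1"
    using assms(4) by (auto simp: K.spanning_trees_eq quotient_graph_simps(2)[OF assms(1)])
  have TG: "T \<subseteq> arcs G" and FG: "F \<subseteq> arcs G"
    using T(1) F(1) assms(1) by auto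
  have nF: "?n F = ?n \<gamma> + 1"
    by (rule ncomp_cut_forest[OF assms(1,3)])
  have n1: "?n (\<gamma> \<union> T) = 1"
    using T(3) ncomp_quotient_graph_eq_1_iff[OF assms(1) TG assms(2)] by simp
  have fin: "finite F" "finite T"
    using FG TG finite_arcs finite_subset by blast+
  have "?n (F \<union> T) + ?n \<gamma> \<le> ?n (\<gamma> \<union> T) + ?n F"
    using F(1) fin tail_head_subset[OF TG] by (intro ncomp_submodular) auto
  then have le: "?n (F \<union> T) \<le> 2"
    using nF n1 by simp
  have "F \<inter> T = {}"
    using F(1) T(1) by auto
  then have "card (F \<union> T) = card F + card T"
    using fin by (simp add: card_Un_disjoint)
  moreover have FT: "F \<union> T \<subseteq> arcs G"
    using FG TG by auto
  \<comment> \<open>Edge counting gives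
    \<open>?n (F \<union> T) = nullity G (F \<union> T) + 2\<close>, so the bound by 2 forces both
    values.\<close>
  ultimately have n2: "nullity G (F \<union> T) = 0" "?n (F \<union> T) = 2"
    using le nF F(2) T(2,3) euler_verts[OF FT] euler_verts[OF FG] euler_quotient_graph[OF assms(1) T(1)]
    by auto
  then show "F \<union> T \<in> spanning_trees 2 G"
    using FT by (simp add: spanning_trees_eq)
  show "(u, v) \<in> linked G F" if uv: "(u, v) \<in> linked G \<gamma>" "(u, v) \<in> linked G (F \<union> T)"
  proof (rule ccontr)
    assume "(u, v) \<notin> linked G F"
    \<comment> \<open>Relative to \<open>F\<close>, \<gamma> performs a single merge, and the pair
      \<open>u\<close>, \<open>v\<close> witnesses that \<open>F \<union> T\<close> performs it
      too.\<close>
    then have *: "linked G \<gamma> \<subseteq> linked G (F \<union> T)"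
      using uv F(1) nF tail_head_subset[OF assms(1)]
      by (intro linked_subset_if_one_merge[of F \<gamma> "verts G"]) auto
    have "(tail G e, head G e) \<in> linked G (F \<union> T)" if "e \<in> \<gamma> \<union> T" for e
      using that * linked_edge[of e \<gamma> G] linked_edge[of e "F \<union> T" G] by blast
    then have "linked G (\<gamma> \<union> T) \<subseteq> linked G (F \<union> T)"
      by (rule linked_least[OF equiv_linked])
    then have "?n (F \<union> T) = 1"
      using n1 ncomp_eq_1_iff[OF finite_verts assms(2)] by blast
    then show False
      using n2 by simp
  qed
qed

text \<open>Converse of the gluing: separating \<open>u\<close> from \<open>v\<close> forces at
  least one extra component of \<open>D \<inter> \<gamma>\<close>, and the degree bound allows at
  most one.\<close>

lemma spanning_2_tree_split:
  assumes "\<gamma> \<subseteq> arcs G" "verts G \<noteq> {}" "D \<in> spanning_trees 2 G"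
    and "card (\<gamma> - D) \<le> nullity G \<gamma> + 1"
    and "(u, v) \<in> linked G \<gamma>" "(u, v) \<notin> linked G D" "u \<in> C" "v \<in> C"
  shows "D \<inter> \<gamma> \<in> cut_forests (edge_subgraph G \<gamma>) C"
    and "D - \<gamma> \<in> spanning_trees 1 (quotient_graph G \<gamma>)"
proof -
  let ?n = "ncomp G (verts G)" and ?K = "quotient_graph G \<gamma>" and ?H = "edge_subgraph G \<gamma>"
  interpret K: fin_digraph ?K
    by (rule fin_digraph_quotient[OF assms(1)])
  interpret H: fin_digraph ?H
    by (rule fin_digraph_edge_subgraph[OF assms(1)])
  have D: "D \<subseteq> arcs G" "nullity G D = 0" "?n D = 2"
    using assms(3) by (auto simp: spanning_trees_eq)
  have fin: "finite D" "finite \<gamma>"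
    using D(1) assms(1) finite_arcs finite_subset by blast+
  have nul: "nullity G (D \<inter> \<gamma>) = 0"
    using nullity_mono[of "D \<inter> \<gamma>" D] D by simp
  have nuv: "(u, v) \<notin> linked G (D \<inter> \<gamma>)"
    using assms(6) linked_mono[of "D \<inter> \<gamma>" D G] by blast
  have c1: "card \<gamma> = card (\<gamma> - D) + card (D \<inter> \<gamma>)" and c2: "card D = card (D - \<gamma>) + card (D \<inter> \<gamma>)"
    using fin card_Int_Diff[of \<gamma> D] card_Int_Diff[of D \<gamma>] by (simp_all add: Int_commute)
  have "linked G \<gamma> \<noteq> linked G (D \<inter> \<gamma>)"
    using assms(5) nuv by blast
  then have "\<not> ncomp G (verts ?H) (D \<inter> \<gamma>) \<le> ncomp G (verts ?H) \<gamma>"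
    using linked_eq_if_ncomp_le[of "D \<inter> \<gamma>" \<gamma> "verts ?H" G] H.finite_verts
    by (auto simp: edge_subgraph_def)
  \<comment> \<open>By the Euler formula the number of extra components is
    \<open>card (\<gamma> - D)\<close> minus the nullity of \<gamma>.\<close>
  moreover have "ncomp G (verts ?H) (D \<inter> \<gamma>) \<le> ncomp G (verts ?H) \<gamma> + 1"
    using assms(4) c1 nul euler_edge_subgraph[OF assms(1), of "D \<inter> \<gamma>"]
      euler_edge_subgraph[OF assms(1), of \<gamma>] by simp
  ultimately show cut: "D \<inter> \<gamma> \<in> cut_forests ?H C"
    using nul nuv assms(7,8) by (auto simp: cut_forests_def)
  \<comment> \<open>Adding \<gamma> joins \<open>u\<close> to \<open>v\<close>, so the two
    components of \<open>D\<close> become one and \<open>D - \<gamma>\<close> connects the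
    quotient.\<close>
  have "linked G (D \<union> \<gamma>) \<noteq> linked G D"
    using assms(5,6) linked_mono[of \<gamma> "D \<union> \<gamma>" G] by blast
  then have "\<not> ?n D \<le> ?n (D \<union> \<gamma>)"
    using linked_eq_if_ncomp_le[of D "D \<union> \<gamma>" "verts G" G] D(1) assms(1)
      tail_head_subset[of "D \<union> \<gamma>"] by auto
  then have "?n (D \<union> \<gamma>) = 1"
    using D(3) ncomp_pos[OF finite_verts assms(2), of G "D \<union> \<gamma>"] by simp
  moreover have "\<gamma> \<union> (D - \<gamma>) = D \<union> \<gamma>" "D - \<gamma> \<subseteq> arcs G - \<gamma>" "D - \<gamma> \<subseteq> arcs G"
    "D \<inter> \<gamma> \<subseteq> arcs G"
    using D(1) by auto
  moreover from this have n1: "ncomp ?K (verts ?K) (D - \<gamma>) = 1"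
    using \<open>?n (D \<union> \<gamma>) = 1\<close> ncomp_quotient_graph_eq_1_iff[OF assms(1) _ assms(2), of "D - \<gamma>"] by simp
  \<comment> \<open>Counting edges of \<open>D\<close> and \<open>D \<inter> \<gamma>\<close> shows
    that \<open>D - \<gamma>\<close> has one edge fewer than the quotient has vertices.\<close>
  ultimately have "nullity ?K (D - \<gamma>) = 0"
    using euler_quotient_graph[OF assms(1), of "D - \<gamma>"] euler_verts[OF D(1)]
      euler_verts[of "D \<inter> \<gamma>"] ncomp_cut_forest[OF assms(1) cut] nul D c2 by simp
  then show "D - \<gamma> \<in> spanning_trees 1 ?K"
    using n1 D(1) by (auto simp: K.spanning_trees_eq quotient_graph_simps(2)[OF assms(1)])
qed

lemma cut_forests_connected:
  assumes "Digraph_Component.connected G" "v \<in> verts G"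
  shows "cut_forests G (component G v) = spanning_trees 2 G"
proof -
  note conn = connected_linked[OF assms(1)]
  have "component G v \<in> components G"
    using assms(2) by (simp add: components_def)
  then have C: "component G v = verts G"
    by (simp add: connected_components[OF conn])
  have "ncomp G (verts G) (arcs G) = 1"
    using conn ncomp_eq_1_iff[OF finite_verts] by blast
  then show ?thesis
    by (auto simp: cut_forests_def spanning_trees_eq C
        ncomp_eq_1_iff[OF finite_verts conn(1), symmetric] simp del: mem_Sigma_iff)
qed

end

section \<open>Momentum flow and the factorization\<close>

lemma flow_square_cong:
  assumes "\<And>j. j \<in> half_edges G \<Longrightarrow>
    (attach G i, attach G j) \<in> linked (skeleton G) F \<longleftrightarrow> (attach G i, attach G j) \<in> linked (skeleton G) F'"
  shows "flow_square G i F = flow_square G i F'"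
proof -
  have "{j \<in> half_edges G. attach G j \<in> linked (skeleton G) F `` {attach G i}} =
      {j \<in> half_edges G. attach G j \<in> linked (skeleton G) F' `` {attach G i}}"
    using assms by auto
  then show ?thesis
    by (simp only: flow_square_def momentum_into_def)
qed

text \<open>If \<open>F\<close> linked all external vertices to that of \<open>i\<close>, the inflow
  would be the total momentum, which is zero.\<close>

lemma flow_square_nonzero:
  assumes "feynman_graph G" "flow_square G i F \<noteq> 0"
  shows "\<exists>j\<in>half_edges G. (attach G i, attach G j) \<notin> linked (skeleton G) F"
proof (rule ccontr)
  assume "\<not> ?thesis"
  then have "{j \<in> half_edges G. attach G j \<in> linked (skeleton G) F `` {attach G i}} = half_edges G"
    by auto
  then have "momentum_into G (linked (skeleton G) F `` {attach G i}) = 0"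
    using assms(1) by (simp only: momentum_into_def feynman_graph_def)
  then show False
    using assms(2) by (simp add: flow_square_def)
qed

lemma feynman_graph_feynman_subgraph:
  assumes "feynman_graph G" "momentum_spanning G \<gamma>"
  shows "feynman_graph (feynman_subgraph G \<gamma>)"
  using assms fin_digraph.fin_digraph_edge_subgraph[of "skeleton G" \<gamma>]
  by (simp add: feynman_graph_def momentum_spanning_def feynman_subgraph_def)

theorem proposition2p4:
  fixes G :: "('v, 'e, 'h, 'd::finite) feynman_graph"
    and \<gamma> :: "'e set"
  assumes "feynman_graph G"
    and "Digraph_Component.connected (skeleton G)"
    and "momentum_spanning G \<gamma>"
  shows "(phi (feynman_subgraph G \<gamma>) \<noteq> 0 \<longrightarrow>
            total_degree (phi (feynman_subgraph G \<gamma>))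
              = loop_number (edge_subgraph (skeleton G) \<gamma>) + 1) \<and>
         (\<exists>R :: 'e polynomial.
            phi G = phi (feynman_subgraph G \<gamma>) * psi (quotient_graph (skeleton G) \<gamma>) + R \<and>
            (\<forall>m\<in>Poly_Mapping.keys R.
               monomial_degree_in \<gamma> m > loop_number (edge_subgraph (skeleton G) \<gamma>) + 1))"
proof (cases "half_edges G = {}")
  case True
  \<comment> \<open>Without external half-edges both polynomials are 0 by convention, and the
    remainder 0 works.\<close>
  then have "phi G = 0" "phi (feynman_subgraph G \<gamma>) = 0"
    by (simp_all add: phi_def feynman_subgraph_def)
  then show ?thesis
    by (intro conjI exI[of _ 0]) auto
next
  case False
  let ?S = "skeleton G"
  interpret fin_digraph ?S
    using assms(1) by (simp add: feynman_graph_def)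
  let ?H = "edge_subgraph ?S \<gamma>" and ?K = "quotient_graph ?S \<gamma>"
  obtain i where i: "i \<in> half_edges G"
    using False by auto
  have \<gamma>: "\<gamma> \<subseteq> arcs ?S"
    using assms(3) by (simp add: momentum_spanning_def)
  have ne: "verts ?S \<noteq> {}"
    by (rule connected_linked(1)[OF assms(2)])
  interpret H: fin_digraph ?H
    by (rule fin_digraph_edge_subgraph[OF \<gamma>])
  \<comment> \<open>The component of \<gamma> that carries all external vertices.\<close>
  define C where "C = component ?H (attach G i)"
  define N where "N = cut_forests ?H C"
  define T where "T = spanning_trees 1 ?K"
  define q where "q = flow_square G i"
  define t where "t D = const (q D) * (\<Prod>e\<in>arcs ?S - D. var e)" for D
  have att: "attach G j \<in> C" if "j \<in> half_edges G" for j
    using that assms(3) i by (auto simp: momentum_spanning_def C_def)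
  have "attach G i \<in> verts ?H"
    using assms(3) i by (auto simp: momentum_spanning_def)
  then have "C = linked ?S \<gamma> `` {attach G i}"
    unfolding C_def by (simp add: H.component_eq_linked)
  then have att_linked: "(attach G i, attach G j) \<in> linked ?S \<gamma>" if "j \<in> half_edges G" for j
    using att[OF that] by simp
  have phiG: "phi G = (\<Sum>D\<in>spanning_trees 2 ?S. t D)"
  proof -
    have "attach G i \<in> verts ?S"
      using assms(1) i by (auto simp: feynman_graph_def)
    then show ?thesis
      by (simp add: phi_eq[OF assms(1) i] cut_forests_connected[OF assms(2)] t_def q_def)
  qed
  have phiH: "phi (feynman_subgraph G \<gamma>) = (\<Sum>F\<in>N. const (q F) * (\<Prod>e\<in>\<gamma> - F. var e))"
    using i by (subst phi_eq[OF feynman_graph_feynman_subgraph[OF assms(1,3)], of i])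
      (simp_all add: feynman_subgraph_def flow_square_def momentum_into_def N_def q_def C_def)
  have psiK: "psi ?K = (\<Sum>F\<in>T. \<Prod>e\<in>arcs ?S - \<gamma> - F. var e)"
    unfolding T_def by (rule psi_quotient_graph[OF \<gamma> assms(2)])
  have FN: "F \<subseteq> \<gamma>" if "F \<in> N" for F
    using that by (simp add: N_def cut_forests_def)
  have FT: "F \<subseteq> arcs ?S - \<gamma>" if "F \<in> T" for F
    using that by (simp add: T_def spanning_trees_def quotient_graph_def)

  let ?u = "\<lambda>(F, F'). F \<union> F'"
  have inj: "inj_on ?u (N \<times> T)"
  \<comment> \<open>Members of \<open>N\<close> lie inside \<gamma> and members of \<open>T\<close>
    outside it, so a union determines its pair.\<close>
  proof (rule inj_on_inverseI[where g = "\<lambda>D. (D \<inter> \<gamma>, D - \<gamma>)"])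
    fix x assume "x \<in> N \<times> T"
    then show "(?u x \<inter> \<gamma>, ?u x - \<gamma>) = x"
      using FN FT by fastforce
  qed
  have img: "?u ` (N \<times> T) \<subseteq> spanning_trees 2 ?S"
    using cut_forest_union_spanning_tree(1)[OF \<gamma> ne] by (auto simp: N_def T_def)
  have fin: "finite (spanning_trees 2 ?S)"
    by (rule finite_subset[of _ "Pow (arcs ?S)"]) (auto simp: spanning_trees_def)
  \<comment> \<open>The remainder collects the spanning 2-trees that do not arise from a pair; some
    of these terms may vanish.\<close>
  define R where "R = (\<Sum>D\<in>spanning_trees 2 ?S - ?u ` (N \<times> T). t D)"
  have t_union: "const (q F) * (\<Prod>e\<in>\<gamma> - F. var e) * (\<Prod>e\<in>arcs ?S - \<gamma> - F'. var e) = t (F \<union> F')"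
    if F: "F \<in> N" "F' \<in> T" for F F'
  proof -
    have "q (F \<union> F') = q F"
      unfolding q_def
    proof (rule flow_square_cong)
      fix j assume "j \<in> half_edges G"
      \<comment> \<open>External vertices are linked in \<gamma>, so a link between them in
        \<open>F \<union> F'\<close> is already one in \<open>F\<close>.\<close>
      then show "(attach G i, attach G j) \<in> linked ?S (F \<union> F') \<longleftrightarrow>
          (attach G i, attach G j) \<in> linked ?S F"
        using cut_forest_union_spanning_tree(2)[OF \<gamma> ne, of F C F'] F att_linked
          linked_mono[of F "F \<union> F'" ?S] by (auto simp: N_def T_def)
    qed
    moreover have "arcs ?S - (F \<union> F') = (\<gamma> - F) \<union> (arcs ?S - \<gamma> - F')"
      using FN[OF F(1)] FT[OF F(2)] \<gamma> by auto
    moreover have "(\<Prod>e\<in>(\<gamma> - F) \<union> (arcs ?S - \<gamma> - F'). var e) =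
        (\<Prod>e\<in>\<gamma> - F. var e) * (\<Prod>e\<in>arcs ?S - \<gamma> - F'. var e)"
      using finite_subset[OF \<gamma> finite_arcs] by (intro prod.union_disjoint) auto
    ultimately show ?thesis
      by (simp add: t_def mult.assoc)
  qed
  have "phi (feynman_subgraph G \<gamma>) * psi ?K = (\<Sum>x\<in>N \<times> T. t (?u x))"
    unfolding phiH psiK sum_product sum.cartesian_product
    by (intro sum.cong refl) (auto simp: t_union)
  also have "\<dots> = (\<Sum>D\<in>?u ` (N \<times> T). t D)"
    by (simp add: sum.reindex[OF inj])
  finally have "phi G = phi (feynman_subgraph G \<gamma>) * psi ?K + R"
    unfolding phiG R_def using sum.subset_diff[OF img fin, of t] by (simp add: add.commute)
  moreover have "monomial_degree_in \<gamma> m > loop_number ?H + 1" if m: "m \<in> Poly_Mapping.keys R" for m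
  proof (rule ccontr)
    \<comment> \<open>A monomial of too small degree comes from some \<open>D\<close> outside the
      image with nonzero flow. Such a \<open>D\<close> separates two external vertices, so it splits
      into a pair and lies in the image after all.\<close>
    assume le: "\<not> ?thesis"
    obtain D where D: "D \<in> spanning_trees 2 ?S" "D \<notin> ?u ` (N \<times> T)" "q D \<noteq> 0"
      "m = indicator_exponent (arcs ?S - D)"
      using m keys_sum_const_mult_prod_var[of q "arcs ?S"] unfolding R_def t_def by blast
    have "monomial_degree_in \<gamma> m = card (\<gamma> - D)"
    proof -
      have "(arcs ?S - D) \<inter> \<gamma> = \<gamma> - D"
        using \<gamma> by auto
      then show ?thesis
        by (simp add: D(4) monomial_degree_in_indicator_exponent)
    qed
    then have card: "card (\<gamma> - D) \<le> nullity ?S \<gamma> + 1"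
      using le by (simp add: loop_number_edge_subgraph)
    obtain j where j: "j \<in> half_edges G" "(attach G i, attach G j) \<notin> linked ?S D"
      using flow_square_nonzero[OF assms(1)] D(3) unfolding q_def by blast
    have "(D \<inter> \<gamma>, D - \<gamma>) \<in> N \<times> T"
      using spanning_2_tree_split[OF \<gamma> ne D(1) card att_linked[OF j(1)] j(2) att[OF i] att[OF j(1)]]
      by (simp add: N_def T_def)
    then have "?u (D \<inter> \<gamma>, D - \<gamma>) \<in> ?u ` (N \<times> T)"
      by (rule imageI)
    moreover have "?u (D \<inter> \<gamma>, D - \<gamma>) = D"
      by auto
    ultimately show False
      using D(2) by simp
  qed
  moreover have "total_degree (phi (feynman_subgraph G \<gamma>)) = loop_number ?H + 1"
    if nz: "phi (feynman_subgraph G \<gamma>) \<noteq> 0"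
  proof -
    let ?k = "Poly_Mapping.keys (phi (feynman_subgraph G \<gamma>))"
    have "monomial_degree_in UNIV m = loop_number ?H + 1" if m: "m \<in> ?k" for m
    proof -
      obtain F where F: "F \<in> N" "m = indicator_exponent (\<gamma> - F)"
        using m keys_sum_const_mult_prod_var[of q \<gamma> N] unfolding phiH by blast
      then show ?thesis
        using card_cut_forest[OF \<gamma>, of F C] finite_subset[OF \<gamma> finite_arcs]
        by (simp add: N_def monomial_degree_in_indicator_exponent loop_number_edge_subgraph)
    qed
    then have "monomial_degree_in UNIV ` ?k = (\<lambda>_. loop_number ?H + 1) ` ?k"
      by (intro image_cong refl)
    \<comment> \<open>A nonzero polynomial has a monomial, so the set under \<open>Max\<close> is a
      singleton and not empty.\<close>
    also have "\<dots> = {loop_number ?H + 1}"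
      using nz by (simp add: image_constant_conv)
    finally show ?thesis
      by (simp add: total_degree_def)
  qed
  ultimately show ?thesis
    by blast
qed

end
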